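(* Let $d\ge2$ and let $\mathcal{S}$ be a submodule of the Drury-Arveson module $H^2_d$ with $\Delta_{R_{\mathcal{S}}}<\infty$ and $P_{\mathcal{S}}=\sum_{i=1}^nM_{p_i}M_{p_i}^*$ for some $n\in\mathbb{N}$ and some non-constant polynomials $p_1,\dots,p_n$. Then $\mathcal{S}$ is not maximal.
   Context: $H^2_d$ is the Drury-Arveson space: the reproducing kernel Hilbert space of holomorphic functions on the unit ball $\mathbb{B}_d\subset\mathbb{C}^d$ with kernel $K_\lambda(z)=\bigl(1-\sum_{j=1}^dz_j\overline{\lambda_j}\bigr)^{-1}$, $\lambda,z\in\mathbb{B}_d$. For a polynomial $p\in\mathbb{C}[z_1,\dots,z_d]$, $M_p$ is the (bounded) operator of multiplication by $p$ on $H^2_d$; $P_{\mathcal{S}}$ is the orthogonal projection of $H^2_d$ onto $\mathcal{S}$. A submodule of $H^2_d$ is a closed subspace $\mathcal{S}$ with $M_{z_i}\mathcal{S}\subseteq\mathcal{S}$ for $i=1,\dots,d$. Put $R_{\mathcal{S}}:=(M_{z_1}|_{\mathcal{S}},\dots,M_{z_d}|_{\mathcal{S}})$, a commuting contractive $d$-tuple on $\mathcal{S}$, where a $d$-tuple $T=(T_1,\dots,T_d)$ of operators is contractive if $\sum_iT_iT_i^*\le I$. For a contractive tuple $T$ let $\Psi_T(X)=\sum_{i=1}^dT_iXT_i^*$, and for $n\in\mathbb{N}=\{1,2,\dots\}$ let $\Delta_T^n:=\dim\overline{\mathrm{ran}}(I-\Psi_T^n(I))$ (the superscript on $\Delta$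 is an index, not a power), $\Delta_T:=\Delta_T^1$. A commuting contractive $d$-tuple $T$ with $\Delta_T<\infty$ on an infinite dimensional Hilbert space is maximal if $\Delta_T^n=\Bigl(\sum_{k=0}^{n-1}\binom{k+d-1}{d-1}\Bigr)\Delta_T$ for all $n\in\mathbb{N}$. The submodule $\mathcal{S}$ is maximal if the tuple $R_{\mathcal{S}}$ is maximal. *)

theory Defs
  imports
    "HOL-Analysis.Analysis"
    "HOL-Library.Function_Algebras"
    "HOL-Library.Poly_Mapping"
    "HOL-Library.Extended_Nat"
begin

section \<open>Hilbert spaces of complex-valued functions\<close>

text \<open>A complex Hilbert space is given by a carrier set \<open>H\<close> of functions \<open>'x \<Rightarrow> complex\<close> and an
  inner product \<open>ip\<close>, linear in the first argument, of which only the values on \<open>H\<close> matter.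
  A closed subspace \<open>S\<close> of \<open>(H, ip)\<close> is thereby the Hilbert space \<open>(S, ip)\<close>. Likewise an operator on
  \<open>(H, ip)\<close> is a total HOL function of which only the values on \<open>H\<close> matter, so that a restriction to
  an invariant subspace is the same HOL function viewed on a smaller carrier.\<close>

definition cscale :: "complex \<Rightarrow> ('x \<Rightarrow> complex) \<Rightarrow> 'x \<Rightarrow> complex"
  where "cscale c f = (\<lambda>x. c * f x)"

global_interpretation fun_space: vector_space "cscale :: complex \<Rightarrow> ('x \<Rightarrow> complex) \<Rightarrow> 'x \<Rightarrow> complex"
  by unfold_locales (auto simp: cscale_def fun_eq_iff algebra_simps)

definition hnorm :: "(('x \<Rightarrow> complex) \<Rightarrow> ('x \<Rightarrow> complex) \<Rightarrow> complex) \<Rightarrow> ('x \<Rightarrow> complex) \<Rightarrow> real"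
  where "hnorm ip f = sqrt (Re (ip f f))"

locale hilbert_function_space =
  fixes H :: "('x \<Rightarrow> complex) set"
    and ip :: "('x \<Rightarrow> complex) \<Rightarrow> ('x \<Rightarrow> complex) \<Rightarrow> complex"
  assumes subspace: "fun_space.subspace H"
    and ip_add_left: "\<lbrakk>f \<in> H; g \<in> H; h \<in> H\<rbrakk> \<Longrightarrow> ip (f + g) h = ip f h + ip g h"
    and ip_scale_left: "\<lbrakk>f \<in> H; g \<in> H\<rbrakk> \<Longrightarrow> ip (cscale c f) g = c * ip f g"
    and ip_commute: "\<lbrakk>f \<in> H; g \<in> H\<rbrakk> \<Longrightarrow> ip g f = cnj (ip f g)"
    and ip_nonneg: "f \<in> H \<Longrightarrow> 0 \<le> Re (ip f f)"
    and ip_definite: "\<lbrakk>f \<in> H; ip f f = 0\<rbrakk> \<Longrightarrow> f = 0"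
    and complete: "\<lbrakk>\<And>n. X n \<in> H; \<And>e. 0 < e \<Longrightarrow> \<exists>N. \<forall>m\<ge>N. \<forall>n\<ge>N. hnorm ip (X m - X n) < e\<rbrakk>
      \<Longrightarrow> \<exists>f\<in>H. (\<lambda>n. hnorm ip (X n - f)) \<longlonglongrightarrow> 0"

text \<open>Functions on a set \<open>D\<close> are represented as total functions vanishing outside \<open>D\<close>. By the
  Moore-Aronszajn theorem a positive semidefinite kernel \<open>k\<close> (with \<open>k w z\<close> standing for
  $K_w(z)$) determines \<open>H\<close>, and \<open>ip\<close> on \<open>H\<close>, uniquely.\<close>

locale reproducing_kernel_hilbert_space = hilbert_function_space H ip
  for D :: "'x set" and k :: "'x \<Rightarrow> 'x \<Rightarrow> complex"
    and H :: "('x \<Rightarrow> complex) set"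
    and ip :: "('x \<Rightarrow> complex) \<Rightarrow> ('x \<Rightarrow> complex) \<Rightarrow> complex" +
  assumes vanishes_outside: "\<lbrakk>f \<in> H; x \<notin> D\<rbrakk> \<Longrightarrow> f x = 0"
    and kernel_mem: "w \<in> D \<Longrightarrow> (\<lambda>z. if z \<in> D then k w z else 0) \<in> H"
    and reproducing: "\<lbrakk>f \<in> H; w \<in> D\<rbrakk> \<Longrightarrow> f w = ip f (\<lambda>z. if z \<in> D then k w z else 0)"

definition hclosure ::
  "('x \<Rightarrow> complex) set \<Rightarrow> (('x \<Rightarrow> complex) \<Rightarrow> ('x \<Rightarrow> complex) \<Rightarrow> complex) \<Rightarrow> ('x \<Rightarrow> complex) set \<Rightarrow>
    ('x \<Rightarrow> complex) set"
  where "hclosure H ip A = {f \<in> H. \<forall>e>0. \<exists>g\<in>A. hnorm ip (f - g) < e}"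

definition closed_subspace ::
  "('x \<Rightarrow> complex) set \<Rightarrow> (('x \<Rightarrow> complex) \<Rightarrow> ('x \<Rightarrow> complex) \<Rightarrow> complex) \<Rightarrow> ('x \<Rightarrow> complex) set \<Rightarrow> bool"
  where "closed_subspace H ip S \<longleftrightarrow>
    S \<subseteq> H \<and> fun_space.subspace S \<and> hclosure H ip S = S"

text \<open>The Hilbert space dimension of a closed subspace is finite if and only if its algebraic
  dimension is, and then they agree. All infinite dimensions are identified to \<open>\<infinity>\<close>.\<close>

definition hdim :: "('x \<Rightarrow> complex) set \<Rightarrow> enat"
  where "hdim V =
    (if \<exists>B. finite B \<and> V \<subseteq> fun_space.span B then enat (fun_space.dim V) else \<infinity>)"

definition hprojection ::
  "(('x \<Rightarrow> complex) \<Rightarrow> ('x \<Rightarrow> complex) \<Rightarrow> complex) \<Rightarrow> ('x \<Rightarrow> complex) set \<Rightarrow>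
    ('x \<Rightarrow> complex) \<Rightarrow> ('x \<Rightarrow> complex)"
  where "hprojection ip S f = (THE g. g \<in> S \<and> (\<forall>s\<in>S. ip (f - g) s = 0))"

definition bounded_operator ::
  "('x \<Rightarrow> complex) set \<Rightarrow> (('x \<Rightarrow> complex) \<Rightarrow> ('x \<Rightarrow> complex) \<Rightarrow> complex) \<Rightarrow>
    (('x \<Rightarrow> complex) \<Rightarrow> ('x \<Rightarrow> complex)) \<Rightarrow> bool"
  where "bounded_operator H ip A \<longleftrightarrow>
    (\<forall>f\<in>H. A f \<in> H) \<and>
    (\<forall>f\<in>H. \<forall>g\<in>H. A (f + g) = A f + A g) \<and>
    (\<forall>c. \<forall>f\<in>H. A (cscale c f) = cscale c (A f)) \<and>
    (\<exists>C. \<forall>f\<in>H. hnorm ip (A f) \<le> C * hnorm ip f)"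

definition hadjoint ::
  "('x \<Rightarrow> complex) set \<Rightarrow> (('x \<Rightarrow> complex) \<Rightarrow> ('x \<Rightarrow> complex) \<Rightarrow> complex) \<Rightarrow>
    (('x \<Rightarrow> complex) \<Rightarrow> ('x \<Rightarrow> complex)) \<Rightarrow> ('x \<Rightarrow> complex) \<Rightarrow> ('x \<Rightarrow> complex)"
  where "hadjoint H ip A g = (THE h. h \<in> H \<and> (\<forall>f\<in>H. ip (A f) g = ip f h))"

definition operator_le ::
  "('x \<Rightarrow> complex) set \<Rightarrow> (('x \<Rightarrow> complex) \<Rightarrow> ('x \<Rightarrow> complex) \<Rightarrow> complex) \<Rightarrow>
    (('x \<Rightarrow> complex) \<Rightarrow> ('x \<Rightarrow> complex)) \<Rightarrow> (('x \<Rightarrow> complex) \<Rightarrow> ('x \<Rightarrow> complex)) \<Rightarrow> bool"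
  where "operator_le H ip A B \<longleftrightarrow>
    (\<forall>f\<in>H. ip (B f - A f) f \<in> \<real> \<and> 0 \<le> Re (ip (B f - A f) f))"

section \<open>Operator tuples and maximality\<close>

text \<open>A \<open>d\<close>-tuple is a family indexed by a finite type \<open>'d\<close> with \<open>d = CARD('d)\<close>.\<close>

definition Psi ::
  "('x \<Rightarrow> complex) set \<Rightarrow> (('x \<Rightarrow> complex) \<Rightarrow> ('x \<Rightarrow> complex) \<Rightarrow> complex) \<Rightarrow>
    ('d::finite \<Rightarrow> ('x \<Rightarrow> complex) \<Rightarrow> ('x \<Rightarrow> complex)) \<Rightarrow>
    (('x \<Rightarrow> complex) \<Rightarrow> ('x \<Rightarrow> complex)) \<Rightarrow> ('x \<Rightarrow> complex) \<Rightarrow> ('x \<Rightarrow> complex)"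
  where "Psi H ip T X = (\<lambda>f. \<Sum>i\<in>UNIV. T i (X (hadjoint H ip (T i) f)))"

definition contractive_tuple ::
  "('x \<Rightarrow> complex) set \<Rightarrow> (('x \<Rightarrow> complex) \<Rightarrow> ('x \<Rightarrow> complex) \<Rightarrow> complex) \<Rightarrow>
    ('d::finite \<Rightarrow> ('x \<Rightarrow> complex) \<Rightarrow> ('x \<Rightarrow> complex)) \<Rightarrow> bool"
  where "contractive_tuple H ip T \<longleftrightarrow>
    (\<forall>i. bounded_operator H ip (T i)) \<and> operator_le H ip (Psi H ip T id) id"

definition commuting_tuple ::
  "('x \<Rightarrow> complex) set \<Rightarrow> ('d::finite \<Rightarrow> ('x \<Rightarrow> complex) \<Rightarrow> ('x \<Rightarrow> complex)) \<Rightarrow> bool"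
  where "commuting_tuple H T \<longleftrightarrow> (\<forall>i j. \<forall>f\<in>H. T i (T j f) = T j (T i f))"

definition Delta ::
  "('x \<Rightarrow> complex) set \<Rightarrow> (('x \<Rightarrow> complex) \<Rightarrow> ('x \<Rightarrow> complex) \<Rightarrow> complex) \<Rightarrow>
    ('d::finite \<Rightarrow> ('x \<Rightarrow> complex) \<Rightarrow> ('x \<Rightarrow> complex)) \<Rightarrow> nat \<Rightarrow> enat"
  where "Delta H ip T n = hdim (hclosure H ip ((\<lambda>f. f - (Psi H ip T ^^ n) id f) ` H))"

definition maximal_tuple ::
  "('x \<Rightarrow> complex) set \<Rightarrow> (('x \<Rightarrow> complex) \<Rightarrow> ('x \<Rightarrow> complex) \<Rightarrow> complex) \<Rightarrow>
    ('d::finite \<Rightarrow> ('x \<Rightarrow> complex) \<Rightarrow> ('x \<Rightarrow> complex)) \<Rightarrow> bool"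
  where "maximal_tuple H ip T \<longleftrightarrow>
    hilbert_function_space H ip \<and> hdim H = \<infinity> \<and>
    commuting_tuple H T \<and> contractive_tuple H ip T \<and> Delta H ip T 1 < \<infinity> \<and>
    (\<forall>n\<ge>1. Delta H ip T n =
      enat (\<Sum>k<n. (k + CARD('d) - 1) choose (CARD('d) - 1)) * Delta H ip T 1)"

section \<open>The Drury-Arveson module\<close>

definition drury_arveson_kernel :: "complex ^ 'd \<Rightarrow> complex ^ 'd \<Rightarrow> complex"
  where "drury_arveson_kernel w z = inverse (1 - (\<Sum>j\<in>UNIV. z $ j * cnj (w $ j)))"

text \<open>Holomorphy of the elements of \<open>H\<close> is a consequence of the choice of kernel and is not required
  separately.\<close>

definition drury_arveson ::
  "(complex ^ 'd \<Rightarrow> complex) set \<Rightarrow>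
    ((complex ^ 'd \<Rightarrow> complex) \<Rightarrow> (complex ^ 'd \<Rightarrow> complex) \<Rightarrow> complex) \<Rightarrow> bool"
  where "drury_arveson H ip \<longleftrightarrow>
    reproducing_kernel_hilbert_space (ball 0 1) drury_arveson_kernel H ip"

definition mult_op ::
  "(complex ^ 'd \<Rightarrow> complex) \<Rightarrow> (complex ^ 'd \<Rightarrow> complex) \<Rightarrow> (complex ^ 'd \<Rightarrow> complex)"
  where "mult_op \<phi> f = (\<lambda>z. \<phi> z * f z)"

definition coord_shift :: "'d \<Rightarrow> (complex ^ 'd \<Rightarrow> complex) \<Rightarrow> (complex ^ 'd \<Rightarrow> complex)"
  where "coord_shift i = mult_op (\<lambda>z. z $ i)"

definition submodule ::
  "(complex ^ 'd \<Rightarrow> complex) set \<Rightarrow>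
    ((complex ^ 'd \<Rightarrow> complex) \<Rightarrow> (complex ^ 'd \<Rightarrow> complex) \<Rightarrow> complex) \<Rightarrow>
    (complex ^ 'd \<Rightarrow> complex) set \<Rightarrow> bool"
  where "submodule H ip S \<longleftrightarrow> closed_subspace H ip S \<and> (\<forall>i. coord_shift i ` S \<subseteq> S)"

text \<open>The tuple $R_{\mathcal S}$ is \<^const>\<open>coord_shift\<close> viewed on the Hilbert space \<open>(S, ip)\<close>; in
  particular its adjoints are taken in \<open>S\<close>.\<close>

definition maximal_submodule ::
  "((complex ^ 'd \<Rightarrow> complex) \<Rightarrow> (complex ^ 'd \<Rightarrow> complex) \<Rightarrow> complex) \<Rightarrow>
    (complex ^ 'd \<Rightarrow> complex) set \<Rightarrow> bool"
  where "maximal_submodule ip S \<longleftrightarrow>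
    maximal_tuple S ip (coord_shift :: 'd::finite \<Rightarrow> _)"

text \<open>Polynomials in variables indexed by \<open>'d\<close>: finitely supported maps from exponent vectors to
  coefficients.\<close>

type_synonym 'd cpoly = "('d \<Rightarrow>\<^sub>0 nat) \<Rightarrow>\<^sub>0 complex"

definition constant_poly :: "'d cpoly \<Rightarrow> bool"
  where "constant_poly p \<longleftrightarrow> (\<exists>c. p = Poly_Mapping.single 0 c)"

definition poly_fun :: "'d::finite cpoly \<Rightarrow> complex ^ 'd \<Rightarrow> complex"
  where "poly_fun p z =
    (\<Sum>m\<in>Poly_Mapping.keys p. Poly_Mapping.lookup p m *
      (\<Prod>i\<in>UNIV. (z $ i) ^ Poly_Mapping.lookup m i))"

end

(* The relation sum_i z_i conj(w_i) K_w = K_w - 1 for the kernel K of the Drury-Arveson space gives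
   P_S K_w = sum_i conj(p_i(w)) p_i K_w, hence I - Psi^n(I) on S has range
   span {z^a p_i : |a| < n}. If the p_i span a space of dimension r, then maximality says that
   the r * #{a : |a| < n} products of monomials with a basis are independent for all n; the
   relation p_2 p_1 - p_1 p_2 = 0 forces r = 1. Then P_S = M_q M_q^* for one polynomial q, and M_q is
   isometric. In particular |z_i q| = |q|, so by contractivity of the row (M_{z_1},...,M_{z_d}) the
   function z_i q is orthogonal to z_j H for j <> i. A difference K_w - K_w' with w, w' differing
   only in the j-th coordinate lies in the closure of z_j H, so q does not depend on z_j. As d >= 2,
   this holds for every j, and q is constant. *)

theory Submission
  imports Defs
begin

section \<open>Hilbert spaces of functions\<close>

text \<open>The space is known only through its kernel, without power series or orthogonality of
  monomials. So even the fact that z_i f lies in \<open>H\<close> has to come out of the kernel: z_i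
  f is obtained as the Riesz representer of a functional prescribed on kernel functions. A similar
  device avoids density arguments for the defect operators: \<open>(f - X n f) w\<close> is the
  inner product of \<open>f\<close> with \<open>kS w - X n (kS w)\<close>, a finite sum in powers of
  \<open>bip z w\<close>, which handles every \<open>f\<close> in \<open>S\<close> at once.

  The dimension count uses two opposite inequalities: the rank r of the generators bounds
  \<open>Delta\<close> at 1 from below, and any finite spanning family of the range bounds
  \<open>Delta\<close> at n from above. A single relation then contradicts maximality, and no exact
  dimension is computed.

  In the rank one case the isometry is used only on 1 and z_i. It comes from comparing q(v) g(v)
  with q(v) h(v), where h is the adjoint of M_q applied to q g. Dividing by q(v) is possible only
  off the zero set, which is why density of the complement of a polynomial zero set and continuity
  of the elements of \<open>H\<close> enter.\<close>

lemma linear_coefficient_zero: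
  fixes b c :: real
  assumes "\<And>t. 0 \<le> 2 * t * b + t\<^sup>2 * c"
  shows "b = 0"
proof (rule ccontr)
  assume b: "b \<noteq> 0"
  \<comment> \<open>Up to replacing \<open>c\<close> by the larger and positive \<open>k\<close>,
    the test point t = -b/k is the minimiser of the quadratic.\<close>
  define k where "k = \<bar>c\<bar> + 1"
  have k: "k > 0" "c < k" by (auto simp: k_def)
  have "0 \<le> 2 * (- b / k) * b + (- b / k)\<^sup>2 * c" by (rule assms)
  also have "\<dots> = (b\<^sup>2 / k) * (c / k - 2)"
    using k by (simp add: field_simps power2_eq_square)
  also have "\<dots> < 0"
    using k b by (intro mult_pos_neg) (auto simp: field_simps)
  finally show False by simp
qed

lemma sum_fun_apply: "(\<Sum>i\<in>A. f i) x = (\<Sum>i\<in>A. f i x)"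
  by (induction A rule: infinite_finite_induct) auto

context hilbert_function_space
begin

lemma mem_zero [simp]: "0 \<in> H"
  using fun_space.subspace_0[OF subspace] .

lemma mem_add [intro, simp]: "f \<in> H \<Longrightarrow> g \<in> H \<Longrightarrow> f + g \<in> H"
  using fun_space.subspace_add[OF subspace] .

lemma mem_diff [intro, simp]: "f \<in> H \<Longrightarrow> g \<in> H \<Longrightarrow> f - g \<in> H"
  using fun_space.subspace_diff[OF subspace] .

lemma mem_scale [intro, simp]: "f \<in> H \<Longrightarrow> cscale c f \<in> H"
  using fun_space.subspace_scale[OF subspace] .

lemma mem_sum [intro]: "(\<And>i. i \<in> A \<Longrightarrow> f i \<in> H) \<Longrightarrow> (\<Sum>i\<in>A. f i) \<in> H"
  using fun_space.subspace_sum[OF subspace] .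

lemma ip_add_right: "\<lbrakk>f \<in> H; g \<in> H; h \<in> H\<rbrakk> \<Longrightarrow> ip h (f + g) = ip h f + ip h g"
  using ip_commute[of "f + g" h] ip_commute[of f h] ip_commute[of g h] by (simp add: ip_add_left)

lemma ip_scale_right: "\<lbrakk>f \<in> H; g \<in> H\<rbrakk> \<Longrightarrow> ip f (cscale c g) = cnj c * ip f g"
  using ip_commute[of "cscale c g" f] ip_commute[of g f] by (simp add: ip_scale_left)

lemma ip_diff_left: "\<lbrakk>f \<in> H; g \<in> H; h \<in> H\<rbrakk> \<Longrightarrow> ip (f - g) h = ip f h - ip g h"
  using ip_add_left[of "f - g" g h] by simp

lemma ip_diff_right: "\<lbrakk>f \<in> H; g \<in> H; h \<in> H\<rbrakk> \<Longrightarrow> ip h (f - g) = ip h f - ip h g"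
  using ip_add_right[of "f - g" g h] by simp

lemma ip_zero_left [simp]: "h \<in> H \<Longrightarrow> ip 0 h = 0"
  using ip_diff_left[of 0 0 h] by simp

lemma ip_zero_right [simp]: "h \<in> H \<Longrightarrow> ip h 0 = 0"
  using ip_diff_right[of 0 0 h] by simp

lemma ip_sum_left:
  "\<lbrakk>\<And>i. i \<in> A \<Longrightarrow> f i \<in> H; h \<in> H\<rbrakk> \<Longrightarrow> ip (\<Sum>i\<in>A. f i) h = (\<Sum>i\<in>A. ip (f i) h)"
  by (induction A rule: infinite_finite_induct) (auto simp: ip_add_left mem_sum)

lemma ip_sum_right:
  "\<lbrakk>\<And>i. i \<in> A \<Longrightarrow> f i \<in> H; h \<in> H\<rbrakk> \<Longrightarrow> ip h (\<Sum>i\<in>A. f i) = (\<Sum>i\<in>A. ip h (f i))"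
  by (induction A rule: infinite_finite_induct) (auto simp: ip_add_right mem_sum)

lemmas ip_simps = ip_add_left ip_add_right ip_diff_left ip_diff_right ip_scale_left ip_scale_right

lemma hnorm_nonneg [simp]: "f \<in> H \<Longrightarrow> 0 \<le> hnorm ip f"
  by (simp add: hnorm_def ip_nonneg)

lemma hnorm_zero [simp]: "hnorm ip 0 = 0"
  by (simp add: hnorm_def)

lemma ip_self: "f \<in> H \<Longrightarrow> ip f f = of_real ((hnorm ip f)\<^sup>2)"
proof -
  assume f: "f \<in> H"
  have "Im (ip f f) = - Im (ip f f)"
    using arg_cong[OF ip_commute[OF f f], of Im] by (simp only: cnj.simps)
  then show ?thesis
    using ip_nonneg[OF f] by (simp add: hnorm_def complex_eq_iff)
qed

lemma hnorm_eq_0: "f \<in> H \<Longrightarrow> hnorm ip f = 0 \<longleftrightarrow> f = 0"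
  using ip_self[of f] ip_definite[of f] by auto

lemma hnorm_add_sq:
  assumes "f \<in> H" "g \<in> H"
  shows "(hnorm ip (f + g))\<^sup>2 = (hnorm ip f)\<^sup>2 + 2 * Re (ip f g) + (hnorm ip g)\<^sup>2"
proof -
  have "ip (f + g) (f + g) = ip f f + ip f g + cnj (ip f g) + ip g g"
    using assms by (simp add: ip_simps ip_commute[of f g])
  then have "Re (ip (f + g) (f + g)) = Re (ip f f) + 2 * Re (ip f g) + Re (ip g g)"
    by simp
  then show ?thesis
    using assms by (simp add: ip_self)
qed

lemma hnorm_cscale: "f \<in> H \<Longrightarrow> hnorm ip (cscale c f) = cmod c * hnorm ip f"
proof -
  assume f: "f \<in> H"
  have "ip (cscale c f) (cscale c f) = (c * cnj c) * ip f f"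
    using f by (simp add: ip_scale_left ip_scale_right)
  also have "\<dots> = of_real ((cmod c * hnorm ip f)\<^sup>2)"
    using f by (simp only: complex_norm_square[symmetric] ip_self power_mult_distrib of_real_mult)
  finally have "ip (cscale c f) (cscale c f) = of_real ((cmod c * hnorm ip f)\<^sup>2)" .
  then have "hnorm ip (cscale c f) = sqrt ((cmod c * hnorm ip f)\<^sup>2)"
    unfolding hnorm_def[of ip "cscale c f"] by simp
  then show ?thesis
    using f by simp
qed

lemma hnorm_diff_sq:
  assumes "f \<in> H" "g \<in> H"
  shows "(hnorm ip (f - g))\<^sup>2 = (hnorm ip f)\<^sup>2 - 2 * Re (ip f g) + (hnorm ip g)\<^sup>2"
  using assms hnorm_add_sq[of "f - g" g] by (simp add: ip_diff_left ip_self)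

lemma hnorm_minus_commute: "\<lbrakk>f \<in> H; g \<in> H\<rbrakk> \<Longrightarrow> hnorm ip (f - g) = hnorm ip (g - f)"
  by (rule power2_eq_imp_eq) (simp_all add: hnorm_diff_sq ip_commute[of f g])

lemma cauchy_schwarz:
  assumes f: "f \<in> H" and g: "g \<in> H"
  shows "cmod (ip f g) \<le> hnorm ip f * hnorm ip g"
proof (cases "g = 0")
  case True
  then show ?thesis using f by simp
next
  case False
  define a where "a = ip f g"
  define s where "s = (hnorm ip g)\<^sup>2"
  have s: "s > 0" using False g by (simp add: s_def hnorm_eq_0)
  \<comment> \<open>This is \<open>s\<close> times the component of \<open>f\<close> orthogonal to
    \<open>g\<close>; scaling by \<open>s\<close> avoids the division.\<close>
  define h where "h = cscale (of_real s) f - cscale a g"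
  have "(hnorm ip h)\<^sup>2 = s\<^sup>2 * (hnorm ip f)\<^sup>2 - 2 * Re (of_real s * cnj a * a) + (cmod a)\<^sup>2 * s"
    unfolding h_def using f g s by (subst hnorm_diff_sq)
      (auto simp: hnorm_cscale ip_scale_left ip_scale_right power_mult_distrib s_def[symmetric]
        a_def[symmetric] algebra_simps)
  also have "of_real s * cnj a * a = of_real (s * (cmod a)\<^sup>2)"
    by (simp add: complex_norm_square mult_ac del: of_real_power)
  finally have "(hnorm ip h)\<^sup>2 = s * (s * (hnorm ip f)\<^sup>2 - (cmod a)\<^sup>2)"
    by (simp add: algebra_simps power2_eq_square)
  then have "0 \<le> s * (s * (hnorm ip f)\<^sup>2 - (cmod a)\<^sup>2)"
    using zero_le_power2[of "hnorm ip h"] by (simp only:)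
  then have "(cmod a)\<^sup>2 \<le> s * (hnorm ip f)\<^sup>2"
    using s by (simp add: zero_le_mult_iff)
  then have "(cmod a)\<^sup>2 \<le> (hnorm ip f * hnorm ip g)\<^sup>2"
    by (simp only: s_def power_mult_distrib mult.commute)
  then show ?thesis
    unfolding a_def by (rule power2_le_imp_le) (simp add: f g)
qed

lemma hnorm_triangle:
  assumes "f \<in> H" "g \<in> H"
  shows "hnorm ip (f + g) \<le> hnorm ip f + hnorm ip g"
proof -
  have "(hnorm ip (f + g))\<^sup>2 \<le> (hnorm ip f + hnorm ip g)\<^sup>2"
    using assms cauchy_schwarz[OF assms] complex_Re_le_cmod[of "ip f g"]
    by (simp add: hnorm_add_sq power2_sum)
  then show ?thesis
    by (rule power2_le_imp_le) (simp add: assms)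
qed

lemma hnorm_triangle_ineq2:
  assumes "f \<in> H" "g \<in> H"
  shows "hnorm ip f - hnorm ip g \<le> hnorm ip (f - g)"
  using hnorm_triangle[of "f - g" g] assms by simp

lemma ip_tendsto:
  assumes X: "\<And>n. X n \<in> H" and g: "g \<in> H" and h: "h \<in> H"
    and lim: "(\<lambda>n. hnorm ip (X n - g)) \<longlonglongrightarrow> 0"
  shows "(\<lambda>n. ip (X n) h) \<longlonglongrightarrow> ip g h"
proof (rule LIM_zero_cancel, rule Lim_null_comparison)
  show "\<forall>\<^sub>F n in sequentially. cmod (ip (X n) h - ip g h) \<le> hnorm ip (X n - g) * hnorm ip h"
    using cauchy_schwarz[of "X _ - g" h] X g h by (simp add: ip_diff_left)
  show "(\<lambda>n. hnorm ip (X n - g) * hnorm ip h) \<longlonglongrightarrow> 0"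
    using tendsto_mult_right[OF lim, of "hnorm ip h"] by simp
qed

lemma hnorm_tendsto:
  assumes X: "\<And>n. X n \<in> H" and g: "g \<in> H"
    and lim: "(\<lambda>n. hnorm ip (X n - g)) \<longlonglongrightarrow> 0"
  shows "(\<lambda>n. hnorm ip (X n)) \<longlonglongrightarrow> hnorm ip g"
proof (rule LIM_zero_cancel, rule Lim_null_comparison[OF _ lim])
  show "\<forall>\<^sub>F n in sequentially. norm (hnorm ip (X n) - hnorm ip g) \<le> hnorm ip (X n - g)"
    using hnorm_triangle_ineq2[of "X _" g] hnorm_triangle_ineq2[of g "X _"]
      hnorm_minus_commute[of g "X _"] X g
    by (intro always_eventually allI) (auto simp: abs_le_iff)
qed

lemma eqI_ip: "\<lbrakk>f \<in> H; g \<in> H; \<And>h. h \<in> H \<Longrightarrow> ip h f = ip h g\<rbrakk> \<Longrightarrow> f = g"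
  using ip_definite[of "f - g"] by (simp add: ip_diff_right)

text \<open>The functional is given by its graph \<open>G\<close>, so that it may be specified on a spanning family
  without first checking that it is well defined.\<close>

lemma riesz_representation:
  assumes GH: "\<And>v c. (v, c) \<in> G \<Longrightarrow> v \<in> H"
    and G0: "(0, 0) \<in> G"
    and Gadd: "\<And>v c v' c'. (v, c) \<in> G \<Longrightarrow> (v', c') \<in> G \<Longrightarrow> (v + v', c + c') \<in> G"
    and Gscale: "\<And>v c a. (v, c) \<in> G \<Longrightarrow> (cscale a v, a * c) \<in> G"
    and bound: "\<And>v c. (v, c) \<in> G \<Longrightarrow> cmod c \<le> C * hnorm ip v"
    and C: "0 \<le> C"
  shows "\<exists>g\<in>H. hnorm ip g \<le> C \<and> (\<forall>v c. (v, c) \<in> G \<longrightarrow> ip v g = c)"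
proof -
  \<comment> \<open>If g represents the functional, then \<open>J (v, c)\<close> is |v - g|^2 -
    |g|^2. Minimising \<open>J\<close> over the graph therefore approximates g.\<close>
  define J where "J = (\<lambda>(v, c). (hnorm ip v)\<^sup>2 - 2 * Re c)"
  have J_lower: "- C\<^sup>2 \<le> J x" if "x \<in> G" for x
  proof -
    obtain v c where x: "x = (v, c)" by force
    have "Re c \<le> C * hnorm ip v"
      using bound that complex_Re_le_cmod[of c] unfolding x by force
    moreover have "0 \<le> (hnorm ip v - C)\<^sup>2" by simp
    ultimately show ?thesis by (simp add: J_def x power2_diff algebra_simps)
  qed
  define I where "I = Inf (J ` G)"
  have bdd: "bdd_below (J ` G)" unfolding bdd_below_def using J_lower by blast
  have I_le: "I \<le> J x" if "x \<in> G" for x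
    unfolding I_def using that bdd by (simp add: cInf_lower)
  have "\<exists>x\<in>G. J x < I + 1 / real (Suc n)" for n
    using cInf_lessD[of "J ` G" "I + 1 / real (Suc n)"] G0 unfolding I_def by fastforce
  then obtain x where x: "\<And>n. x n \<in> G" "\<And>n. J (x n) < I + 1 / real (Suc n)"
    by metis
  define V where "V n = fst (x n)" for n
  define c where "c n = snd (x n)" for n
  have VG: "(V n, c n) \<in> G" for n using x(1) by (simp add: V_def c_def)
  have V: "V n \<in> H" for n using GH[OF VG] .
  have Jx: "(hnorm ip (V n))\<^sup>2 - 2 * Re (c n) < I + 1 / real (Suc n)" for n
    using x(2)[of n] by (simp add: J_def V_def c_def case_prod_unfold)
  have dist: "(hnorm ip (V m - V n))\<^sup>2 \<le> 2 / real (Suc m) + 2 / real (Suc n)" for m n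
  proof -
    \<comment> \<open>The midpoint lies in the graph, so its \<open>J\<close> is at least
      \<open>I\<close>; the parallelogram law then makes a minimising sequence Cauchy.\<close>
    have "(cscale (1/2) (V m + V n), 1/2 * (c m + c n)) \<in> G"
      by (intro Gscale Gadd VG)
    from I_le[OF this]
    have "I \<le> (hnorm ip (V m + V n))\<^sup>2 / 4 - Re (c m) - Re (c n)"
      using V by (simp add: J_def hnorm_cscale power_mult_distrib power_divide add_divide_distrib)
    with Jx[of m] Jx[of n] show ?thesis
      using hnorm_add_sq[OF V[of m] V[of n]] hnorm_diff_sq[OF V[of m] V[of n]]
      by (simp add: algebra_simps)
  qed
  have "\<exists>N. \<forall>m\<ge>N. \<forall>n\<ge>N. hnorm ip (V m - V n) < e" if e: "0 < e" for e
  proof -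
    obtain N where N: "4 / e\<^sup>2 < real N" using reals_Archimedean2 by blast
    have N0: "N > 0" using N e by (intro gr0I) (auto simp: zero_less_divide_iff not_less)
    have "hnorm ip (V m - V n) < e" if "m \<ge> N" "n \<ge> N" for m n
    proof -
      have "2 / real (Suc m) \<le> 2 / real N" "2 / real (Suc n) \<le> 2 / real N"
        using that N0 by (auto intro!: divide_left_mono)
      with dist[of m n] have "(hnorm ip (V m - V n))\<^sup>2 \<le> 4 / real N" by simp
      also have "\<dots> < e\<^sup>2" using N N0 e by (simp add: field_simps)
      finally show ?thesis by (rule power2_less_imp_less) (use e in simp)
    qed
    then show ?thesis by blast
  qed
  from complete[of V, OF V this] obtain g
    where g: "g \<in> H" and lim: "(\<lambda>n. hnorm ip (V n - g)) \<longlonglongrightarrow> 0" by blast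
  have Re_eq: "Re (ip u g) = Re b" if ub: "(u, b) \<in> G" for u b
  proof -
    have u: "u \<in> H" using GH[OF ub] .
    \<comment> \<open>First variation: moving \<open>V n\<close> by t u cannot bring
      \<open>J\<close> below \<open>I\<close>, and the excess 1/(n+1) of \<open>V n\<close>
      disappears in the limit.\<close>
    have "0 \<le> 2 * t * (Re (ip g u) - Re b) + t\<^sup>2 * (hnorm ip u)\<^sup>2" for t
    proof (rule LIMSEQ_le_const)
      have "(\<lambda>n. ip (V n) u) \<longlonglongrightarrow> ip g u" by (rule ip_tendsto[OF V g u lim])
      then have "(\<lambda>n. 2 * t * (Re (ip (V n) u) - Re b) + t\<^sup>2 * (hnorm ip u)\<^sup>2 + 1 / real (Suc n))
          \<longlonglongrightarrow> 2 * t * (Re (ip g u) - Re b) + t\<^sup>2 * (hnorm ip u)\<^sup>2 + 0"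
        by (intro tendsto_intros tendsto_Re LIMSEQ_inverse_real_of_nat[unfolded inverse_eq_divide])
      then show "(\<lambda>n. 2 * t * (Re (ip (V n) u) - Re b) + t\<^sup>2 * (hnorm ip u)\<^sup>2 + 1 / real (Suc n))
          \<longlonglongrightarrow> 2 * t * (Re (ip g u) - Re b) + t\<^sup>2 * (hnorm ip u)\<^sup>2" by simp
      have "0 \<le> 2 * t * (Re (ip (V n) u) - Re b) + t\<^sup>2 * (hnorm ip u)\<^sup>2 + 1 / real (Suc n)" for n
      proof -
        have "(V n + cscale (of_real t) u, c n + of_real t * b) \<in> G"
          by (intro Gscale Gadd VG ub)
        from I_le[OF this] have "I \<le> (hnorm ip (V n + cscale (of_real t) u))\<^sup>2 - 2 * Re (c n) - 2 * t * Re b"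
          by (simp add: J_def)
        also have "(hnorm ip (V n + cscale (of_real t) u))\<^sup>2
            = (hnorm ip (V n))\<^sup>2 + 2 * t * Re (ip (V n) u) + t\<^sup>2 * (hnorm ip u)\<^sup>2"
          using V u by (subst hnorm_add_sq) (auto simp: ip_scale_right hnorm_cscale power_mult_distrib)
        finally show ?thesis using Jx[of n] by (simp add: algebra_simps)
      qed
      then show "\<exists>N. \<forall>n\<ge>N. 0 \<le> 2 * t * (Re (ip (V n) u) - Re b) + t\<^sup>2 * (hnorm ip u)\<^sup>2 + 1 / real (Suc n)"
        by blast
    qed
    then have "Re (ip g u) - Re b = 0" by (rule linear_coefficient_zero)
    then show ?thesis using ip_commute[OF g u] by simp
  qed
  have eq: "ip u g = b" if ub: "(u, b) \<in> G" for u b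
  proof -
    have u: "u \<in> H" using GH[OF ub] .
    \<comment> \<open>The imaginary part is recovered from the real part at \<i> u.\<close>
    have "Re (ip (cscale \<i> u) g) = Re (\<i> * b)" by (intro Re_eq Gscale ub)
    then show ?thesis using Re_eq[OF ub] u g by (simp add: ip_scale_left complex_eq_iff)
  qed
  \<comment> \<open>The bound is available on the graph only, and \<open>g\<close> is merely a limit
    of first components of graph points; hence the passage through \<open>V n\<close>.\<close>
  have "cmod (ip g g) \<le> C * hnorm ip g"
  proof (rule LIMSEQ_le)
    show "(\<lambda>n. cmod (ip (V n) g)) \<longlonglongrightarrow> cmod (ip g g)"
      by (intro tendsto_norm ip_tendsto[OF V g g lim])
    show "(\<lambda>n. C * hnorm ip (V n)) \<longlonglongrightarrow> C * hnorm ip g"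
      by (intro tendsto_mult_left hnorm_tendsto[OF V g lim])
    show "\<exists>N. \<forall>n\<ge>N. cmod (ip (V n) g) \<le> C * hnorm ip (V n)"
      using eq[OF VG] bound[OF VG] by simp
  qed
  then have "hnorm ip g * hnorm ip g \<le> C * hnorm ip g"
    using g by (simp add: ip_self power2_eq_square norm_mult)
  then have "hnorm ip g \<le> C"
    using hnorm_nonneg[OF g] C by (cases "hnorm ip g = 0") auto
  with g eq show ?thesis by blast
qed

section \<open>Adjoints and projections as Riesz representers\<close>

lemma hadjoint_eqI:
  assumes "h \<in> H" "\<And>f. f \<in> H \<Longrightarrow> ip (A f) g = ip f h"
  shows "hadjoint H ip A g = h"
  unfolding hadjoint_def
proof (rule the_equality)
  show "h \<in> H \<and> (\<forall>f\<in>H. ip (A f) g = ip f h)" using assms by blast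
  show "h' = h" if h': "h' \<in> H \<and> (\<forall>f\<in>H. ip (A f) g = ip f h')" for h'
  proof (rule eqI_ip)
    show "ip f h' = ip f h" if f: "f \<in> H" for f
    proof -
      have "ip (A f) g = ip f h'" using h' f by blast
      then show ?thesis using assms(2)[OF f] by simp
    qed
  qed (use h' assms in auto)
qed

lemma hadjoint_exists:
  assumes A: "bounded_operator H ip A" and g: "g \<in> H"
  shows "\<exists>h\<in>H. \<forall>f\<in>H. ip (A f) g = ip f h"
proof -
  obtain C where AH: "\<And>f. f \<in> H \<Longrightarrow> A f \<in> H"
    and Aadd: "\<And>f g. f \<in> H \<Longrightarrow> g \<in> H \<Longrightarrow> A (f + g) = A f + A g"
    and Ascale: "\<And>c f. f \<in> H \<Longrightarrow> A (cscale c f) = cscale c (A f)"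
    and C: "\<And>f. f \<in> H \<Longrightarrow> hnorm ip (A f) \<le> C * hnorm ip f"
    using A unfolding bounded_operator_def by blast
  let ?G = "{(f, ip (A f) g) |f. f \<in> H}"
  \<comment> \<open>The absolute value is there because \<open>C\<close> may be negative when
    \<open>H\<close> is trivial.\<close>
  have "\<exists>h\<in>H. hnorm ip h \<le> \<bar>C\<bar> * hnorm ip g \<and> (\<forall>v c. (v, c) \<in> ?G \<longrightarrow> ip v h = c)"
  proof (rule riesz_representation)
    have "A 0 = 0" using Ascale[of 0 0] by simp
    then show "(0, 0) \<in> ?G" using g by (intro CollectI exI[of _ 0]) auto
    show "cmod c \<le> \<bar>C\<bar> * hnorm ip g * hnorm ip v" if "(v, c) \<in> ?G" for v c
    proof -
      have v: "v \<in> H" "c = ip (A v) g" using that by auto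
      have "cmod c \<le> hnorm ip (A v) * hnorm ip g" using v AH g cauchy_schwarz by simp
      also have "\<dots> \<le> (\<bar>C\<bar> * hnorm ip v) * hnorm ip g"
        using C[OF v(1)] v g
        by (intro mult_right_mono order.trans[OF C[OF v(1)]]) (auto intro!: mult_right_mono)
      finally show ?thesis by (simp add: mult_ac)
    qed
  qed (use g AH Aadd Ascale in \<open>auto simp: ip_add_left ip_scale_left intro!: mult_nonneg_nonneg\<close>)
  then obtain h where h: "h \<in> H" and eq: "\<forall>v c. (v, c) \<in> ?G \<longrightarrow> ip v h = c"
    by (elim bexE conjE)
  have "ip (A f) g = ip f h" if "f \<in> H" for f
    using eq[rule_format, of f "ip (A f) g"] that by auto
  with h show ?thesis by blast
qed

lemma
  assumes A: "bounded_operator H ip A" and g: "g \<in> H"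
  shows hadjoint_mem: "hadjoint H ip A g \<in> H"
    and hadjoint_ip: "\<And>f. f \<in> H \<Longrightarrow> ip (A f) g = ip f (hadjoint H ip A g)"
proof -
  obtain h where h: "h \<in> H" "\<forall>f\<in>H. ip (A f) g = ip f h"
    using hadjoint_exists[OF A g] by blast
  then have "hadjoint H ip A g = h" by (intro hadjoint_eqI) auto
  with h show "hadjoint H ip A g \<in> H" "\<And>f. f \<in> H \<Longrightarrow> ip (A f) g = ip f (hadjoint H ip A g)"
    by auto
qed

text \<open>The projection of \<open>f\<close> is the Riesz representer, inside the Hilbert space
  \<open>S\<close>, of the functional sending s to \<open>ip s f\<close>.\<close>

lemma
  assumes SH: "S \<subseteq> H" and S: "hilbert_function_space S ip" and f: "f \<in> H"
  shows hprojection_mem: "hprojection ip S f \<in> S"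
    and hprojection_ip: "\<And>s. s \<in> S \<Longrightarrow> ip s (hprojection ip S f) = ip s f"
proof -
  interpret S: hilbert_function_space S ip by (rule S)
  let ?G = "{(s, ip s f) |s. s \<in> S}"
  have "\<exists>g\<in>S. hnorm ip g \<le> hnorm ip f \<and> (\<forall>v c. (v, c) \<in> ?G \<longrightarrow> ip v g = c)"
    by (rule S.riesz_representation)
      (use f SH cauchy_schwarz in \<open>auto simp: ip_add_left ip_scale_left subset_iff mult.commute\<close>)
  then obtain g where g0: "g \<in> S" and eq: "\<forall>v c. (v, c) \<in> ?G \<longrightarrow> ip v g = c"
    by (elim bexE conjE)
  have "ip s g = ip s f" if "s \<in> S" for s
    using eq[rule_format, of s "ip s f"] that by auto
  note g = g0 this
  have orth: "(\<forall>s\<in>S. ip (f - h) s = 0) \<longleftrightarrow> (\<forall>s\<in>S. ip s h = ip s f)" if "h \<in> S" for h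
  proof -
    have "ip (f - h) s = 0 \<longleftrightarrow> ip s h = ip s f" if s: "s \<in> S" for s
    proof -
      have "ip (f - h) s = cnj (ip s f - ip s h)"
        using s \<open>h \<in> S\<close> SH f ip_commute[of s "f - h"] by (auto simp: ip_diff_right subset_iff)
      then show ?thesis by auto
    qed
    then show ?thesis by blast
  qed
  have "hprojection ip S f = g"
    unfolding hprojection_def
  proof (rule the_equality)
    show "g \<in> S \<and> (\<forall>s\<in>S. ip (f - g) s = 0)"
      using g orth by blast
    show "h = g" if "h \<in> S \<and> (\<forall>s\<in>S. ip (f - h) s = 0)" for h
      using that g orth by (intro S.eqI_ip[of h g]) (blast, blast, metis (no_types))
  qed
  with g show "hprojection ip S f \<in> S" "\<And>s. s \<in> S \<Longrightarrow> ip s (hprojection ip S f) = ip s f"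
    by auto
qed

section \<open>Finite-dimensional subspaces\<close>

lemma span_subset: "B \<subseteq> H \<Longrightarrow> fun_space.span B \<subseteq> H"
  using fun_space.span_minimal[OF _ subspace] .

lemma ip_span_eq_0:
  assumes "B \<subseteq> H" "f \<in> H" "\<And>b. b \<in> B \<Longrightarrow> ip f b = 0" "s \<in> fun_space.span B"
  shows "ip f s = 0"
proof -
  have "fun_space.subspace {s \<in> H. ip f s = 0}"
    using assms by (auto intro!: fun_space.subspaceI simp: ip_add_right ip_scale_right)
  then have "fun_space.span B \<subseteq> {s \<in> H. ip f s = 0}"
    using assms by (intro fun_space.span_minimal) auto
  then show ?thesis using assms by auto
qed

text \<open>Gram-Schmidt: the new vector is first made orthogonal to the old span, then one
  coefficient corrects the old projection.\<close>

lemma finite_span_projection: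
  assumes "finite B" "B \<subseteq> H" "f \<in> H"
  shows "\<exists>g\<in>fun_space.span B. \<forall>b\<in>fun_space.span B. ip (f - g) b = 0"
  using assms
proof (induction B arbitrary: f rule: finite_induct)
  case empty
  have "ip f 0 = 0" using empty by (intro ip_zero_right) auto
  then show ?case by (simp only: fun_space.span_empty ball_simps bex_simps diff_zero simp_thms)
next
  case (insert b B)
  obtain g where g: "g \<in> fun_space.span B" "\<forall>c\<in>fun_space.span B. ip (f - g) c = 0"
    using insert by blast
  obtain b0 where b0: "b0 \<in> fun_space.span B" "\<forall>c\<in>fun_space.span B. ip (b - b0) c = 0"
    using insert.IH[of b] insert.prems by blast
  have BH: "fun_space.span B \<subseteq> H" using insert.prems span_subset by simp
  define e where "e = b - b0"
  have mem: "g \<in> H" "b0 \<in> H" "b \<in> H" "e \<in> H" "f \<in> H"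
    using g b0 BH insert.prems by (auto simp: e_def)
  \<comment> \<open>If \<open>b\<close> already lies in the old span, then \<open>e\<close> is 0 and
    division by zero gives t = 0, so \<open>g'\<close> is \<open>g\<close>.\<close>
  define t where "t = ip (f - g) e / ip e e"
  define g' where "g' = g + cscale t e"
  have sub: "fun_space.span B \<subseteq> fun_space.span (insert b B)"
    by (intro fun_space.span_mono) auto
  have e_span: "e \<in> fun_space.span (insert b B)"
    unfolding e_def using b0 sub by (intro fun_space.span_diff) (auto intro: fun_space.span_base)
  have g'_span: "g' \<in> fun_space.span (insert b B)"
    unfolding g'_def using g e_span sub by (auto intro!: fun_space.span_add fun_space.span_scale)
  have g': "g' \<in> H" using mem by (simp add: g'_def)
  have orthB: "ip (f - g') c = 0" if "c \<in> fun_space.span B" for c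
  proof -
    have eq: "f - g' = (f - g) - cscale t e" by (simp add: g'_def algebra_simps)
    have c: "c \<in> H" "ip (f - g) c = 0" "ip e c = 0"
      using that g(2) b0(2) BH by (auto simp: e_def)
    have "ip ((f - g) - cscale t e) c = ip (f - g) c - t * ip e c"
      using c(1) mem by (subst ip_diff_left) (auto simp: ip_scale_left)
    then show ?thesis by (simp add: eq c)
  qed
  have orthe: "ip (f - g') e = 0"
  proof -
    have eq: "f - g' = (f - g) - cscale t e" by (simp add: g'_def algebra_simps)
    show ?thesis unfolding eq
      using mem ip_definite[of e] by (cases "ip e e = 0") (auto simp: ip_diff_left ip_scale_left t_def)
  qed
  have "ip (f - g') c = 0" if "c \<in> insert b B" for c
  proof (cases "c = b")
    case True
    have "ip (f - g') (e + b0) = 0"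
      using orthe orthB b0 mem g' by (subst ip_add_right) auto
    then show ?thesis using True by (simp add: e_def)
  next
    case False
    then show ?thesis using that orthB by (auto intro: fun_space.span_base)
  qed
  then have "\<forall>c\<in>fun_space.span (insert b B). ip (f - g') c = 0"
    using ip_span_eq_0[of "insert b B" "f - g'"] insert.prems(1) g' mem(5) by blast
  then show ?case using g'_span by blast
qed

text \<open>By Pythagoras no point of the span is closer to \<open>f\<close> than its projection, so
  a limit of such points equals its projection. This makes the closure in \<open>Delta\<close>
  harmless for upper bounds.\<close>

lemma hclosure_span_subset:
  assumes B: "finite B" "B \<subseteq> H" and A: "A \<subseteq> fun_space.span B"
  shows "hclosure H ip A \<subseteq> fun_space.span B"
proof
  fix f assume f: "f \<in> hclosure H ip A"
  then have fH: "f \<in> H" by (simp add: hclosure_def)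
  obtain g where g: "g \<in> fun_space.span B" "\<forall>c\<in>fun_space.span B. ip (f - g) c = 0"
    using finite_span_projection[OF B fH] by blast
  have BH: "fun_space.span B \<subseteq> H" using span_subset[OF B(2)] .
  have le: "hnorm ip (f - g) \<le> 0 + e" if e: "e > 0" for e
  proof -
    obtain a where a: "a \<in> A" "hnorm ip (f - a) < e" using f e by (auto simp: hclosure_def)
    have aB: "a \<in> fun_space.span B" using a A by auto
    have "(hnorm ip (f - a))\<^sup>2 = (hnorm ip ((f - g) + (g - a)))\<^sup>2" by simp
    also have "\<dots> = (hnorm ip (f - g))\<^sup>2 + (hnorm ip (g - a))\<^sup>2"
      using g aB fH BH fun_space.span_diff[OF g(1) aB] by (subst hnorm_add_sq) auto
    finally have "(hnorm ip (f - g))\<^sup>2 \<le> (hnorm ip (f - a))\<^sup>2" by simp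
    then have "hnorm ip (f - g) \<le> hnorm ip (f - a)"
      by (rule power2_le_imp_le) (use fH BH aB in auto)
    then show ?thesis using a by simp
  qed
  have "hnorm ip (f - g) \<le> 0" by (rule field_le_epsilon) (rule le)
  moreover have "f - g \<in> H" using fH g BH by auto
  ultimately have "f - g = 0" using hnorm_eq_0[of "f - g"] hnorm_nonneg[of "f - g"] by linarith
  then show "f \<in> fun_space.span B" using g by simp
qed

end

section \<open>Row contraction and multipliers of the Drury-Arveson space\<close>

definition bip :: "complex ^ 'd \<Rightarrow> complex ^ 'd \<Rightarrow> complex"
  where "bip z w = (\<Sum>j\<in>UNIV. z $ j * cnj (w $ j))"

lemma norm_bip_le: "cmod (bip z w) \<le> norm z * norm w"
proof -
  have "cmod (bip z w) \<le> (\<Sum>j\<in>UNIV. \<bar>cmod (z $ j)\<bar> * \<bar>cmod (w $ j)\<bar>)"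
    unfolding bip_def by (rule order.trans[OF norm_sum]) (simp add: norm_mult)
  also have "\<dots> \<le> norm z * norm w"
    unfolding norm_vec_def by (rule L2_set_mult_ineq)
  finally show ?thesis .
qed

lemma bip_neq_1:
  assumes "z \<in> ball 0 1" "w \<in> ball 0 1"
  shows "bip z w \<noteq> 1"
proof
  assume "bip z w = 1"
  then have "1 \<le> norm z * norm w" using norm_bip_le[of z w] by simp
  also have "norm z * norm w < 1 * 1"
    using assms by (intro mult_strict_mono') auto
  finally show False by simp
qed

lemma bip_zero_left [simp]: "bip 0 w = 0" and bip_zero_right [simp]: "bip z 0 = 0"
  by (auto simp: bip_def)

lemma cscale_apply [simp]: "cscale c f x = c * f x"
  by (simp add: cscale_def)

lemma mult_op_add: "mult_op \<phi> (f + g) = mult_op \<phi> f + mult_op \<phi> g"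
  by (auto simp: mult_op_def fun_eq_iff algebra_simps)

lemma mult_op_cscale: "mult_op \<phi> (cscale c f) = cscale c (mult_op \<phi> f)"
  by (auto simp: mult_op_def cscale_def fun_eq_iff)

locale drury_arveson_space =
  fixes H :: "(complex ^ 'd::finite \<Rightarrow> complex) set"
    and ip :: "(complex ^ 'd \<Rightarrow> complex) \<Rightarrow> (complex ^ 'd \<Rightarrow> complex) \<Rightarrow> complex"
  assumes drury_arveson: "drury_arveson H ip"

sublocale drury_arveson_space \<subseteq>
  reproducing_kernel_hilbert_space "ball 0 1" drury_arveson_kernel H ip
  using drury_arveson by (simp add: drury_arveson_def)

context drury_arveson_space
begin

abbreviation D :: "(complex ^ 'd) set" where "D \<equiv> ball 0 1"

definition K :: "complex ^ 'd \<Rightarrow> complex ^ 'd \<Rightarrow> complex"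
  where "K w = (\<lambda>z. if z \<in> D then drury_arveson_kernel w z else 0)"

lemma K_mem [simp]: "w \<in> D \<Longrightarrow> K w \<in> H"
  unfolding K_def by (rule kernel_mem)

lemma ip_K: "f \<in> H \<Longrightarrow> w \<in> D \<Longrightarrow> ip f (K w) = f w"
  unfolding K_def by (rule reproducing[symmetric])

lemma K_eq: "z \<in> D \<Longrightarrow> K w z = 1 / (1 - bip z w)"
  by (simp add: K_def drury_arveson_kernel_def bip_def divide_inverse)

lemma K_recursion: "z \<in> D \<Longrightarrow> w \<in> D \<Longrightarrow> K w z = 1 + bip z w * K w z"
  using bip_neq_1[of z w] by (simp add: K_eq field_simps)

lemma K_outside: "z \<notin> D \<Longrightarrow> K w z = 0"
  by (auto simp: K_def)

lemma K_0: "z \<in> D \<Longrightarrow> K 0 z = 1"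
  by (simp add: K_eq)

lemma eqI_D: "\<lbrakk>f \<in> H; g \<in> H; \<And>z. z \<in> D \<Longrightarrow> f z = g z\<rbrakk> \<Longrightarrow> f = g"
  by (metis ext vanishes_outside)

definition kcomb :: "(complex ^ 'd) set \<Rightarrow> (complex ^ 'd \<Rightarrow> complex) \<Rightarrow> complex ^ 'd \<Rightarrow> complex"
  where "kcomb A a = (\<Sum>w\<in>A. cscale (a w) (K w))"

lemma kcomb_mem: "A \<subseteq> D \<Longrightarrow> kcomb A a \<in> H"
  unfolding kcomb_def by (intro mem_sum mem_scale K_mem) auto

lemma ip_kcomb:
  assumes "A \<subseteq> D"
  shows "ip (kcomb A a) (kcomb A b) = (\<Sum>w\<in>A. \<Sum>v\<in>A. a w * cnj (b v) * K w v)"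
proof -
  have "ip (kcomb A a) (kcomb A b) = (\<Sum>w\<in>A. ip (cscale (a w) (K w)) (kcomb A b))"
    unfolding kcomb_def[of A a] using assms by (intro ip_sum_left) (auto simp: kcomb_mem)
  also have "\<dots> = (\<Sum>w\<in>A. \<Sum>v\<in>A. ip (cscale (a w) (K w)) (cscale (b v) (K v)))"
    unfolding kcomb_def using assms by (intro sum.cong ip_sum_right refl) (auto simp: subset_iff)
  also have "\<dots> = (\<Sum>w\<in>A. \<Sum>v\<in>A. a w * cnj (b v) * K w v)"
    using assms by (intro sum.cong refl)
      (auto simp: subset_iff ip_scale_left ip_scale_right ip_K cscale_apply)
  finally show ?thesis .
qed

text \<open>Combinations over different point sets are brought onto their union by coefficients 0.
  The indicator is written as a factor so that it commutes with the factors
  \<open>cnj (w $ j)\<close> of the column map.\<close>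

lemma kcomb_extend:
  "finite B \<Longrightarrow> A \<subseteq> B \<Longrightarrow> kcomb B (\<lambda>w. (if w \<in> A then 1 else 0) * a w) = kcomb A a"
  unfolding kcomb_def by (intro sum.mono_neutral_cong_right) (auto simp: cscale_def fun_eq_iff)

lemma kcomb_add: "kcomb A a + kcomb A b = kcomb A (\<lambda>w. a w + b w)"
  unfolding kcomb_def sum.distrib[symmetric]
  by (intro sum.cong refl) (auto simp: cscale_def fun_eq_iff algebra_simps)

lemma kcomb_cscale: "cscale c (kcomb A a) = kcomb A (\<lambda>w. c * a w)"
  unfolding kcomb_def fun_space.scale_sum_right
  by (intro sum.cong refl) (auto simp: cscale_def fun_eq_iff algebra_simps)

text \<open>Since $\sum_j z_j \overline{w_j} K_w(z) = K_w(z) - 1$, the map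
  $K_w \mapsto (\overline{w_j} K_w)_j$, which is the adjoint of the row $(M_{z_1},\dots,M_{z_d})$,
  is a contraction.\<close>

lemma kcomb_column:
  assumes A: "A \<subseteq> D"
  shows "(\<Sum>j\<in>UNIV. (hnorm ip (kcomb A (\<lambda>w. cnj (w $ j) * a w)))\<^sup>2) \<le> (hnorm ip (kcomb A a))\<^sup>2"
proof -
  have "(\<Sum>j\<in>UNIV. ip (kcomb A (\<lambda>w. cnj (w $ j) * a w)) (kcomb A (\<lambda>w. cnj (w $ j) * a w)))
      = (\<Sum>j\<in>UNIV. \<Sum>w\<in>A. \<Sum>v\<in>A. (cnj (w $ j) * a w) * cnj (cnj (v $ j) * a v) * K w v)"
    by (simp add: ip_kcomb[OF A])
  also have "\<dots> = (\<Sum>w\<in>A. \<Sum>v\<in>A. \<Sum>j\<in>UNIV. (cnj (w $ j) * a w) * cnj (cnj (v $ j) * a v) * K w v)"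
    by (subst sum.swap, rule sum.cong[OF refl], rule sum.swap)
  also have "\<dots> = (\<Sum>w\<in>A. \<Sum>v\<in>A. a w * cnj (a v) * (bip v w * K w v))"
    by (intro sum.cong refl) (simp add: bip_def sum_distrib_left sum_distrib_right mult_ac)
  also have "\<dots> = (\<Sum>w\<in>A. \<Sum>v\<in>A. a w * cnj (a v) * K w v - a w * cnj (a v))"
  proof (intro sum.cong refl)
    fix w v assume "w \<in> A" "v \<in> A"
    then have "K w v = 1 + bip v w * K w v" using A by (intro K_recursion) auto
    then have "bip v w * K w v = K w v - 1" by (metis add_diff_cancel_left')
    then show "a w * cnj (a v) * (bip v w * K w v) = a w * cnj (a v) * K w v - a w * cnj (a v)"
      by (simp only: right_diff_distrib mult_1_right)
  qed
  \<comment> \<open>The loss is the squared modulus of the coefficient sum, which is the value of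
    \<open>kcomb A a\<close> at 0: the defect of the row is the projection onto the
    constants.\<close>
  also have "\<dots> = ip (kcomb A a) (kcomb A a) - (\<Sum>w\<in>A. a w) * cnj (\<Sum>w\<in>A. a w)"
    by (simp add: ip_kcomb[OF A] sum_subtractf sum_product cnj_sum)
  also have "\<dots> = of_real ((hnorm ip (kcomb A a))\<^sup>2 - (cmod (\<Sum>w\<in>A. a w))\<^sup>2)"
    by (simp only: ip_self[OF kcomb_mem[OF A]] complex_norm_square of_real_diff)
  finally have "complex_of_real (\<Sum>j\<in>UNIV. (hnorm ip (kcomb A (\<lambda>w. cnj (w $ j) * a w)))\<^sup>2)
      = of_real ((hnorm ip (kcomb A a))\<^sup>2 - (cmod (\<Sum>w\<in>A. a w))\<^sup>2)"
    by (simp add: ip_self[OF kcomb_mem[OF A]])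
  then show ?thesis
    unfolding of_real_eq_iff by simp
qed

text \<open>The row is the adjoint of the contractive column map of \<open>kcomb_column\<close>.
  Membership in \<open>H\<close> is the real issue, and it is settled by constructing the function
  as a Riesz representer and then evaluating that at each point.\<close>

lemma row_contraction:
  assumes F: "\<And>j. F j \<in> H"
  shows "(\<lambda>z. \<Sum>j\<in>UNIV. z $ j * F j z) \<in> H" (is "?g \<in> H")
    and "(hnorm ip (\<lambda>z. \<Sum>j\<in>UNIV. z $ j * F j z))\<^sup>2 \<le> (\<Sum>j\<in>UNIV. (hnorm ip (F j))\<^sup>2)"
proof -
  define L where "L A a j = kcomb A (\<lambda>w. cnj (w $ j) * a w)" for A a j
  define C where "C = L2_set (\<lambda>j. hnorm ip (F j)) UNIV"
  \<comment> \<open>Different \<open>A\<close> and \<open>a\<close> may give the same combination of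
    kernel functions; as a graph, the functional need not be checked to be well defined, since the
    bound forces it.\<close>
  let ?G = "{(kcomb A a, \<Sum>j\<in>UNIV. ip (L A a j) (F j)) |A a. finite A \<and> A \<subseteq> D}"
  have L_mem: "L A a j \<in> H" if "A \<subseteq> D" for A a j
    using that by (simp add: L_def kcomb_mem)
  have L_add: "L A (\<lambda>w. a w + b w) j = L A a j + L A b j" for A a b j
    unfolding L_def kcomb_add by (simp add: algebra_simps)
  have L_cscale: "L A (\<lambda>w. c * a w) j = cscale c (L A a j)" for A a c j
    unfolding L_def kcomb_cscale by (simp add: algebra_simps)
  have L_extend: "L B (\<lambda>w. (if w \<in> A then 1 else 0) * a w) j = L A a j"
    if "finite B" "A \<subseteq> B" for A B a j
    using kcomb_extend[OF that, of "\<lambda>w. cnj (w $ j) * a w"] unfolding L_def by (simp add: mult_ac)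
  have "\<exists>g\<in>H. hnorm ip g \<le> C \<and> (\<forall>v c. (v, c) \<in> ?G \<longrightarrow> ip v g = c)"
  proof (rule riesz_representation)
    show "v \<in> H" if "(v, c) \<in> ?G" for v c using that kcomb_mem by auto
    show "(0, 0) \<in> ?G"
      using F by (intro CollectI exI[of _ "{}"] exI[of _ "\<lambda>_. 0"]) (auto simp: kcomb_def L_def)
    show "(cscale a v, a * c) \<in> ?G" if vc: "(v, c) \<in> ?G" for v c a
    proof -
      obtain A b where A: "finite A" "A \<subseteq> D"
        and eq: "v = kcomb A b" "c = (\<Sum>j\<in>UNIV. ip (L A b j) (F j))"
        using vc by auto
      have "a * c = (\<Sum>j\<in>UNIV. ip (L A (\<lambda>w. a * b w) j) (F j))"
        using A F L_mem by (simp add: L_cscale eq sum_distrib_left ip_scale_left)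
      then show ?thesis using A unfolding eq(1) kcomb_cscale by blast
    qed
    show "(v + v', c + c') \<in> ?G" if vc: "(v, c) \<in> ?G" "(v', c') \<in> ?G" for v c v' c'
    proof -
      obtain A b where A: "finite A" "A \<subseteq> D"
        and eq: "v = kcomb A b" "c = (\<Sum>j\<in>UNIV. ip (L A b j) (F j))"
        using vc by auto
      obtain A' b' where A': "finite A'" "A' \<subseteq> D"
        and eq': "v' = kcomb A' b'" "c' = (\<Sum>j\<in>UNIV. ip (L A' b' j) (F j))"
        using vc by auto
      let ?B = "A \<union> A'"
      let ?e = "\<lambda>w. (if w \<in> A then 1 else 0) * b w" and ?e' = "\<lambda>w. (if w \<in> A' then 1 else 0) * b' w"
      have B: "finite ?B" "?B \<subseteq> D" using A A' by auto
      have "v + v' = kcomb ?B (\<lambda>w. ?e w + ?e' w)"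
        unfolding kcomb_add[symmetric] eq eq' using B by (simp only: kcomb_extend Un_upper1 Un_upper2)
      moreover have "c + c' = (\<Sum>j\<in>UNIV. ip (L ?B (\<lambda>w. ?e w + ?e' w) j) (F j))"
        unfolding L_add using B A A' F L_mem
        by (simp only: L_extend Un_upper1 Un_upper2 ip_add_left eq eq' sum.distrib)
      ultimately show ?thesis using B by blast
    qed
    show "cmod c \<le> C * hnorm ip v" if vc: "(v, c) \<in> ?G" for v c
    proof -
      obtain A b where A: "finite A" "A \<subseteq> D"
        and eq: "v = kcomb A b" "c = (\<Sum>j\<in>UNIV. ip (L A b j) (F j))"
        using vc by auto
      have "cmod c \<le> (\<Sum>j\<in>UNIV. cmod (ip (L A b j) (F j)))"
        unfolding eq by (rule norm_sum)
      also have "\<dots> \<le> (\<Sum>j\<in>UNIV. \<bar>hnorm ip (L A b j)\<bar> * \<bar>hnorm ip (F j)\<bar>)"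
        using F L_mem[OF A(2)] cauchy_schwarz by (intro sum_mono) simp
      also have "\<dots> \<le> L2_set (\<lambda>j. hnorm ip (L A b j)) UNIV * C"
        unfolding C_def by (rule L2_set_mult_ineq)
      also have "\<dots> \<le> hnorm ip v * C"
      proof (rule mult_right_mono)
        have "L2_set (\<lambda>j. hnorm ip (L A b j)) UNIV \<le> sqrt ((hnorm ip v)\<^sup>2)"
          unfolding L2_set_def L_def eq by (rule real_sqrt_le_mono, rule kcomb_column[OF A(2)])
        then show "L2_set (\<lambda>j. hnorm ip (L A b j)) UNIV \<le> hnorm ip v"
          using kcomb_mem[OF A(2)] eq by simp
        show "0 \<le> C" by (simp add: C_def)
      qed
      finally show ?thesis by (simp add: mult.commute)
    qed
    show "0 \<le> C" by (simp add: C_def)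
  qed
  then obtain g where g: "g \<in> H" "hnorm ip g \<le> C" "\<And>v c. (v, c) \<in> ?G \<Longrightarrow> ip v g = c"
    by blast
  have "g z = ?g z" for z
  proof (cases "z \<in> D")
    case True
    \<comment> \<open>Testing the representer on a single kernel function reads off its value at
      \<open>z\<close>.\<close>
    have "ip (kcomb {z} (\<lambda>_. 1)) g = (\<Sum>j\<in>UNIV. ip (L {z} (\<lambda>_. 1) j) (F j))"
      using True by (intro g(3)) blast
    then have "ip (K z) g = (\<Sum>j\<in>UNIV. cnj (z $ j) * ip (K z) (F j))"
      using True F by (simp add: L_def kcomb_def ip_scale_left)
    then have "cnj (ip (K z) g) = (\<Sum>j\<in>UNIV. z $ j * cnj (ip (K z) (F j)))"
      by (simp add: cnj_sum)
    then show ?thesis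
      using True F g by (simp add: ip_commute[symmetric] ip_K)
  next
    case False
    then show ?thesis using F g by (simp add: vanishes_outside)
  qed
  then have eq: "g = ?g" by (rule ext)
  show "?g \<in> H" using g eq by simp
  have "(hnorm ip g)\<^sup>2 \<le> C\<^sup>2" using g by (intro power_mono) auto
  also have "C\<^sup>2 = (\<Sum>j\<in>UNIV. (hnorm ip (F j))\<^sup>2)"
    by (simp add: C_def L2_set_def sum_nonneg)
  finally show "(hnorm ip ?g)\<^sup>2 \<le> (\<Sum>j\<in>UNIV. (hnorm ip (F j))\<^sup>2)" using eq by simp
qed

lemma
  assumes f: "f \<in> H"
  shows coord_shift_mem: "coord_shift i f \<in> H"
    and coord_shift_norm_le: "hnorm ip (coord_shift i f) \<le> hnorm ip f"
proof -
  let ?F = "\<lambda>j. if j = i then f else 0"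
  have F: "\<And>j. ?F j \<in> H" using f by simp
  have eq: "(\<lambda>z. \<Sum>j\<in>UNIV. z $ j * ?F j z) = coord_shift i f"
    by (auto simp: coord_shift_def mult_op_def fun_eq_iff if_distrib if_distribR cong: if_cong)
  have "(\<Sum>j\<in>UNIV. (hnorm ip (?F j))\<^sup>2) = (hnorm ip f)\<^sup>2"
    by (simp add: if_distrib if_distribR cong: if_cong)
  then have "(hnorm ip (coord_shift i f))\<^sup>2 \<le> (hnorm ip f)\<^sup>2"
    using row_contraction(2)[of ?F, OF F] unfolding eq by simp
  then show "hnorm ip (coord_shift i f) \<le> hnorm ip f"
    by (rule power2_le_imp_le) (simp add: f)
  show "coord_shift i f \<in> H"
    using row_contraction(1)[of ?F, OF F] unfolding eq .
qed

text \<open>This is the row applied to the tuple of all conj(w_j) f. The constant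
  \<open>norm w\<close> is less than 1 on the ball, which later makes an iteration converge.\<close>

lemma
  assumes f: "f \<in> H"
  shows mult_bip_mem: "mult_op (\<lambda>z. bip z w) f \<in> H"
    and mult_bip_norm_le: "hnorm ip (mult_op (\<lambda>z. bip z w) f) \<le> norm w * hnorm ip f"
proof -
  let ?F = "\<lambda>j. cscale (cnj (w $ j)) f"
  have F: "\<And>j. ?F j \<in> H" using f by simp
  have eq: "(\<lambda>z. \<Sum>j\<in>UNIV. z $ j * ?F j z) = mult_op (\<lambda>z. bip z w) f"
    by (auto simp: bip_def mult_op_def fun_eq_iff cscale_def sum_distrib_left mult_ac)
  have "(\<Sum>j\<in>UNIV. (hnorm ip (?F j))\<^sup>2) = (norm w * hnorm ip f)\<^sup>2"
    using f by (simp add: hnorm_cscale power_mult_distrib norm_vec_def L2_set_def sum_nonneg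
        sum_distrib_right)
  then have "(hnorm ip (mult_op (\<lambda>z. bip z w) f))\<^sup>2 \<le> (norm w * hnorm ip f)\<^sup>2"
    using row_contraction(2)[of ?F, OF F] unfolding eq by simp
  then show "hnorm ip (mult_op (\<lambda>z. bip z w) f) \<le> norm w * hnorm ip f"
    by (rule power2_le_imp_le) (simp add: f)
  show "mult_op (\<lambda>z. bip z w) f \<in> H"
    using row_contraction(1)[of ?F, OF F] unfolding eq .
qed

text \<open>The norm bound is built in, so that a multiplier is a bounded operator and has an
  adjoint without an appeal to the closed graph theorem.\<close>

definition multiplier :: "(complex ^ 'd \<Rightarrow> complex) \<Rightarrow> bool"
  where "multiplier \<phi> \<longleftrightarrow>
    (\<exists>C. \<forall>f\<in>H. mult_op \<phi> f \<in> H \<and> hnorm ip (mult_op \<phi> f) \<le> C * hnorm ip f)"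

lemma multiplier_const: "multiplier (\<lambda>_. c)"
proof -
  have "mult_op (\<lambda>_. c) f = cscale c f" for f :: "complex ^ 'd \<Rightarrow> complex"
    by (auto simp: mult_op_def cscale_def)
  then show ?thesis unfolding multiplier_def by (intro exI[of _ "cmod c"]) (auto simp: hnorm_cscale)
qed

lemma multiplier_coord: "multiplier (\<lambda>z. z $ i)"
  unfolding multiplier_def using coord_shift_mem coord_shift_norm_le
  by (intro exI[of _ 1]) (auto simp: coord_shift_def)

lemma multiplier_add:
  assumes "multiplier \<phi>" "multiplier \<psi>"
  shows "multiplier (\<lambda>z. \<phi> z + \<psi> z)"
proof -
  obtain C where C: "\<And>f. f \<in> H \<Longrightarrow> mult_op \<phi> f \<in> H \<and> hnorm ip (mult_op \<phi> f) \<le> C * hnorm ip f"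
    using assms(1) unfolding multiplier_def by blast
  obtain C' where C': "\<And>f. f \<in> H \<Longrightarrow> mult_op \<psi> f \<in> H \<and> hnorm ip (mult_op \<psi> f) \<le> C' * hnorm ip f"
    using assms(2) unfolding multiplier_def by blast
  have eq: "mult_op (\<lambda>z. \<phi> z + \<psi> z) f = mult_op \<phi> f + mult_op \<psi> f" for f
    by (auto simp: mult_op_def fun_eq_iff algebra_simps)
  have "hnorm ip (mult_op \<phi> f + mult_op \<psi> f) \<le> (C + C') * hnorm ip f" if f: "f \<in> H" for f
    using hnorm_triangle[of "mult_op \<phi> f" "mult_op \<psi> f"] C[OF f] C'[OF f] by (simp add: algebra_simps)
  then show ?thesis unfolding multiplier_def eq using C C' by blast
qed

lemma multiplier_mult:
  assumes "multiplier \<phi>" "multiplier \<psi>"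
  shows "multiplier (\<lambda>z. \<phi> z * \<psi> z)"
proof -
  obtain C where C: "\<And>f. f \<in> H \<Longrightarrow> mult_op \<phi> f \<in> H \<and> hnorm ip (mult_op \<phi> f) \<le> C * hnorm ip f"
    using assms(1) unfolding multiplier_def by blast
  obtain C' where C': "\<And>f. f \<in> H \<Longrightarrow> mult_op \<psi> f \<in> H \<and> hnorm ip (mult_op \<psi> f) \<le> C' * hnorm ip f"
    using assms(2) unfolding multiplier_def by blast
  have eq: "mult_op (\<lambda>z. \<phi> z * \<psi> z) f = mult_op \<phi> (mult_op \<psi> f)" for f
    by (auto simp: mult_op_def fun_eq_iff algebra_simps)
  have "hnorm ip (mult_op \<phi> (mult_op \<psi> f)) \<le> (\<bar>C\<bar> * C') * hnorm ip f" if f: "f \<in> H" for f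
  proof -
    have g: "mult_op \<psi> f \<in> H" using C'[OF f] by simp
    have "hnorm ip (mult_op \<phi> (mult_op \<psi> f)) \<le> C * hnorm ip (mult_op \<psi> f)"
      using C[OF g] by simp
    also have "\<dots> \<le> \<bar>C\<bar> * hnorm ip (mult_op \<psi> f)"
      using g by (intro mult_right_mono) auto
    also have "\<dots> \<le> \<bar>C\<bar> * (C' * hnorm ip f)"
      using C'[OF f] by (intro mult_left_mono) auto
    finally show ?thesis by (simp add: mult_ac)
  qed
  then show ?thesis unfolding multiplier_def eq using C C' by blast
qed

lemma multiplier_sum: "(\<And>i. i \<in> A \<Longrightarrow> multiplier (\<phi> i)) \<Longrightarrow> multiplier (\<lambda>z. \<Sum>i\<in>A. \<phi> i z)"
  by (induction A rule: infinite_finite_induct) (auto intro: multiplier_add multiplier_const)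

lemma multiplier_prod: "(\<And>i. i \<in> A \<Longrightarrow> multiplier (\<phi> i)) \<Longrightarrow> multiplier (\<lambda>z. \<Prod>i\<in>A. \<phi> i z)"
  by (induction A rule: infinite_finite_induct) (auto intro: multiplier_mult multiplier_const)

lemma multiplier_power: "multiplier \<phi> \<Longrightarrow> multiplier (\<lambda>z. \<phi> z ^ n)"
  by (induction n) (auto intro: multiplier_mult multiplier_const)

lemma multiplier_poly_fun: "multiplier (poly_fun p)"
  unfolding poly_fun_def[abs_def]
  by (intro multiplier_sum multiplier_mult multiplier_prod multiplier_power multiplier_const
      multiplier_coord)

lemma multiplier_mem: "multiplier \<phi> \<Longrightarrow> f \<in> H \<Longrightarrow> mult_op \<phi> f \<in> H"
  unfolding multiplier_def by blast

lemma multiplier_bounded: "multiplier \<phi> \<Longrightarrow> bounded_operator H ip (mult_op \<phi>)"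
  unfolding multiplier_def bounded_operator_def mult_op_add mult_op_cscale by blast

lemma hadjoint_multiplier_K:
  assumes \<phi>: "multiplier \<phi>" and w: "w \<in> D"
  shows "hadjoint H ip (mult_op \<phi>) (K w) = cscale (cnj (\<phi> w)) (K w)"
proof (rule hadjoint_eqI)
  show "cscale (cnj (\<phi> w)) (K w) \<in> H" using w by simp
  fix f assume f: "f \<in> H"
  then have "ip (mult_op \<phi> f) (K w) = \<phi> w * f w"
    using multiplier_mem[OF \<phi> f] w by (simp add: ip_K mult_op_def)
  then show "ip (mult_op \<phi> f) (K w) = ip f (cscale (cnj (\<phi> w)) (K w))"
    using f w by (simp add: ip_K ip_scale_right)
qed

text \<open>The difference f(v) - f(w) is the pairing of \<open>f\<close> with
  \<open>K v - K w\<close>, whose norm is an explicit continuous expression in v that vanishes at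
  w.\<close>

lemma continuous_on_D:
  assumes f: "f \<in> H"
  shows "continuous_on D f"
  unfolding continuous_on_def
proof (intro ballI)
  fix w assume w: "w \<in> D"
  let ?k = "\<lambda>z v. 1 / (1 - bip z v)"
  let ?h = "\<lambda>v. hnorm ip f * sqrt (Re (?k v v) - 2 * Re (?k w v) + Re (?k w w))"
  show "(f \<longlongrightarrow> f w) (at w within D)"
  proof (rule LIM_zero_cancel, rule Lim_null_comparison)
    have "cmod (f v - f w) \<le> ?h v" if v: "v \<in> D" for v
    proof -
      have "f v - f w = ip f (K v - K w)"
        using f v w by (simp add: ip_diff_right ip_K)
      then have le: "cmod (f v - f w) \<le> hnorm ip f * hnorm ip (K v - K w)"
        using f v w cauchy_schwarz by simp
      have sq: "(hnorm ip (K u))\<^sup>2 = Re (?k u u)" if "u \<in> D" for u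
        using ip_K[of "K u" u] ip_self[of "K u"] K_eq[of u u] that
        by (metis K_mem Re_complex_of_real)
      have "(hnorm ip (K v - K w))\<^sup>2 = Re (?k v v) - 2 * Re (?k w v) + Re (?k w w)"
        using v w by (simp add: hnorm_diff_sq sq ip_K K_eq)
      then have "hnorm ip (K v - K w) = sqrt (Re (?k v v) - 2 * Re (?k w v) + Re (?k w w))"
        using v w by (metis K_mem hnorm_nonneg mem_diff real_sqrt_unique)
      with le show ?thesis by simp
    qed
    then show "\<forall>\<^sub>F v in at w within D. cmod (f v - f w) \<le> ?h v"
      by (auto simp: eventually_at intro!: exI[of _ 1])
    have "isCont ?h w"
      using bip_neq_1[OF w w] unfolding bip_def by (intro continuous_intros) auto
    then have "(?h \<longlongrightarrow> ?h w) (at w within D)"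
      unfolding isCont_def by (rule tendsto_within_subset) simp
    then show "(?h \<longlongrightarrow> 0) (at w within D)" by simp
  qed
qed

end

section \<open>Monomials and dimension counts\<close>

definition mon :: "('d::finite \<Rightarrow> nat) \<Rightarrow> complex ^ 'd \<Rightarrow> complex"
  where "mon \<alpha> = (\<lambda>z. \<Prod>i\<in>UNIV. (z $ i) ^ \<alpha> i)"

definition exps :: "nat \<Rightarrow> ('d::finite \<Rightarrow> nat) set"
  where "exps k = {\<alpha>. sum \<alpha> UNIV = k}"

definition exps_less :: "nat \<Rightarrow> ('d::finite \<Rightarrow> nat) set"
  where "exps_less n = {\<alpha>. sum \<alpha> UNIV < n}"

text \<open>Stars and bars: an enumeration of the index type turns exponent functions into lists of
  naturals with prescribed length and sum.\<close>

lemma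
  shows card_exps: "card (exps k :: ('d::finite \<Rightarrow> nat) set) = (k + CARD('d) - 1) choose (CARD('d) - 1)"
    and finite_exps: "finite (exps k :: ('d \<Rightarrow> nat) set)"
proof -
  obtain xs :: "'d list" where xs: "set xs = UNIV" "distinct xs"
    using finite_distinct_list[of "UNIV :: 'd set"] by auto
  have len: "length xs = CARD('d)" using distinct_card[OF xs(2)] xs(1) by simp
  let ?L = "{l::nat list. size l = CARD('d) \<and> sum_list l = k}"
  have "bij_betw (\<lambda>\<alpha>. map \<alpha> xs) (exps k) ?L"
  proof (rule bij_betwI')
    show "(map \<alpha> xs = map \<beta> xs) = (\<alpha> = \<beta>)" for \<alpha> \<beta> :: "'d \<Rightarrow> nat"
      using xs(1) by (auto simp: map_eq_conv fun_eq_iff)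
    show "map \<alpha> xs \<in> ?L" if "\<alpha> \<in> exps k" for \<alpha>
      using that xs len by (simp add: exps_def sum_list_distinct_conv_sum_set)
    show "\<exists>\<alpha>\<in>exps k. l = map \<alpha> xs" if l: "l \<in> ?L" for l
    proof -
      define \<alpha> where "\<alpha> x = the (map_of (zip xs l) x)" for x
      have eq: "l = map \<alpha> xs"
      proof (rule nth_equalityI)
        show "length l = length (map \<alpha> xs)" using l len by simp
        show "l ! i = map \<alpha> xs ! i" if "i < length l" for i
          using that l len xs(2) by (simp add: \<alpha>_def map_of_zip_nth)
      qed
      have "sum \<alpha> UNIV = sum_list (map \<alpha> xs)"
        using xs by (simp add: sum_list_distinct_conv_sum_set)
      then have "\<alpha> \<in> exps k" using l eq by (simp add: exps_def)
      then show ?thesis using eq by blast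
    qed
  qed
  note bij = this
  have "finite ?L"
  proof (rule finite_subset)
    show "?L \<subseteq> {l. set l \<subseteq> {..k} \<and> length l = CARD('d)}"
      using member_le_sum_list by fastforce
    show "finite {l. set l \<subseteq> {..k} \<and> length l = CARD('d)}"
      by (rule finite_lists_length_eq) simp
  qed
  then show "finite (exps k :: ('d \<Rightarrow> nat) set)"
    using bij bij_betw_finite by blast
  have "card (exps k :: ('d \<Rightarrow> nat) set) = (k + CARD('d) - 1) choose k"
    using bij_betw_same_card[OF bij] card_length_sum_list[of "CARD('d)" k] by simp
  also have "\<dots> = (k + CARD('d) - 1) choose (CARD('d) - 1)"
    by (subst binomial_symmetric) auto
  finally show "card (exps k :: ('d::finite \<Rightarrow> nat) set) = (k + CARD('d) - 1) choose (CARD('d) - 1)" .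
qed

lemma exps_less_eq: "exps_less n = (\<Union>k<n. exps k)"
  by (auto simp: exps_def exps_less_def)

lemma finite_exps_less: "finite (exps_less n)"
  unfolding exps_less_eq by (intro finite_UN_I finite_exps) auto

lemma card_exps_less:
  "card (exps_less n :: ('d::finite \<Rightarrow> nat) set)
    = (\<Sum>k<n. (k + CARD('d) - 1) choose (CARD('d) - 1))"
  unfolding exps_less_eq card_exps[symmetric]
  by (rule card_UN_disjoint) (auto simp: finite_exps, auto simp: exps_def)

lemma exps_less_mono: "m \<le> n \<Longrightarrow> exps_less m \<subseteq> exps_less n"
  by (auto simp: exps_less_def)

lemma mon_step: "z $ j * mon \<alpha> z = mon (\<alpha>(j := Suc (\<alpha> j))) z"
proof -
  have "mon (\<alpha>(j := Suc (\<alpha> j))) z = (\<Prod>i\<in>UNIV. (if i = j then z $ j else 1) * (z $ i) ^ \<alpha> i)"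
    unfolding mon_def by (intro prod.cong) auto
  then show ?thesis by (simp add: prod.distrib mon_def)
qed

lemma exps_step: "\<alpha> \<in> exps k \<Longrightarrow> \<alpha>(j := Suc (\<alpha> j)) \<in> exps (Suc k)"
proof -
  have "sum (\<alpha>(j := Suc (\<alpha> j))) UNIV = (\<Sum>i\<in>UNIV. \<alpha> i + (if i = j then 1 else 0))"
    by (intro sum.cong) auto
  then show "\<alpha> \<in> exps k \<Longrightarrow> \<alpha>(j := Suc (\<alpha> j)) \<in> exps (Suc k)"
    by (simp add: exps_def sum.distrib)
qed

lemma mult_op_span:
  assumes "f \<in> fun_space.span V"
  shows "mult_op \<psi> f \<in> fun_space.span (mult_op \<psi> ` V)"
proof -
  let ?W = "{f. mult_op \<psi> f \<in> fun_space.span (mult_op \<psi> ` V)}"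
  have "mult_op \<psi> 0 = 0" by (auto simp: mult_op_def)
  then have "fun_space.subspace ?W"
    by (auto intro!: fun_space.subspaceI fun_space.span_add fun_space.span_scale fun_space.span_zero
        simp: mult_op_add mult_op_cscale)
  then have "fun_space.span V \<subseteq> ?W"
    by (intro fun_space.span_minimal) (auto intro: fun_space.span_base)
  with assms show ?thesis by blast
qed

text \<open>The coefficients of a polynomial, indexed by plain functions instead of \<open>'d \<Rightarrow>\<^sub>0 nat\<close>.\<close>

definition pcoeff :: "'d::finite cpoly \<Rightarrow> ('d \<Rightarrow> nat) \<Rightarrow> complex"
  where "pcoeff p \<alpha> = Poly_Mapping.lookup p (Abs_poly_mapping \<alpha>)"

lemma lookup_Abs_finite [simp]: "Poly_Mapping.lookup (Abs_poly_mapping (\<alpha> :: 'd::finite \<Rightarrow> nat)) = \<alpha>"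
  by (simp add: Abs_poly_mapping_inverse)

lemma Abs_lookup [simp]: "Abs_poly_mapping (Poly_Mapping.lookup m) = m"
  by (rule lookup_inverse)

lemma poly_fun_eq:
  fixes p :: "'d::finite cpoly"
  shows "poly_fun p z = (\<Sum>\<alpha>\<in>Poly_Mapping.lookup ` Poly_Mapping.keys p. pcoeff p \<alpha> * mon \<alpha> z)"
  unfolding poly_fun_def mon_def
  by (subst sum.reindex) (auto simp: pcoeff_def inj_on_def poly_mapping_eqI)

lemma pcoeff_eq_0: "\<alpha> \<notin> Poly_Mapping.lookup ` Poly_Mapping.keys p \<Longrightarrow> pcoeff p \<alpha> = 0"
  unfolding pcoeff_def
  by (metis image_eqI in_keys_iff lookup_Abs_finite)

text \<open>A threshold instead of a single degree lets two polynomials be expanded over the same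
  set of exponents.\<close>

lemma poly_fun_eq_exps:
  fixes p :: "'d::finite cpoly"
  obtains N where "\<And>n z. N \<le> n \<Longrightarrow> poly_fun p z = (\<Sum>\<alpha>\<in>exps_less n. pcoeff p \<alpha> * mon \<alpha> z)"
proof -
  let ?A = "Poly_Mapping.lookup ` Poly_Mapping.keys p"
  \<comment> \<open>The sum of all degrees in the support is a crude bound for each of them;
    \<open>Suc\<close> is due to the strict inequality in \<open>exps_less\<close>.\<close>
  define N where "N = Suc (\<Sum>\<alpha>\<in>?A. sum \<alpha> UNIV)"
  have sub: "?A \<subseteq> exps_less N"
  proof
    fix \<alpha> assume "\<alpha> \<in> ?A"
    then have "sum \<alpha> UNIV \<le> (\<Sum>\<alpha>\<in>?A. sum \<alpha> UNIV)"
      by (intro member_le_sum) auto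
    then show "\<alpha> \<in> exps_less N" by (simp add: exps_less_def N_def)
  qed
  have "poly_fun p z = (\<Sum>\<alpha>\<in>exps_less n. pcoeff p \<alpha> * mon \<alpha> z)" if "N \<le> n" for n z
    unfolding poly_fun_eq
  proof (rule sum.mono_neutral_left)
    show "?A \<subseteq> exps_less n" using sub exps_less_mono[OF that] by (rule order.trans)
  qed (auto simp: finite_exps_less pcoeff_eq_0)
  then show ?thesis by (rule that)
qed

lemma dim_family_less:
  assumes I: "finite I" and rel: "(\<Sum>i\<in>I. cscale (u i) (v i)) = 0" and j: "j \<in> I" "u j \<noteq> 0"
  shows "v ` I \<subseteq> fun_space.span (v ` (I - {j}))"
proof -
  have "(\<Sum>i\<in>I. cscale (u i) (v i)) = cscale (u j) (v j) + (\<Sum>i\<in>I - {j}. cscale (u i) (v i))"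
    by (rule sum.remove[OF I j(1)])
  then have eq: "cscale (u j) (v j) = - (\<Sum>i\<in>I - {j}. cscale (u i) (v i))"
    using rel by (simp add: eq_neg_iff_add_eq_0)
  have vj_eq: "v j = cscale (1 / u j) (- (\<Sum>i\<in>I - {j}. cscale (u i) (v i)))"
    unfolding eq[symmetric] using j(2) by simp
  have vj: "v j \<in> fun_space.span (v ` (I - {j}))"
    by (subst vj_eq, intro fun_space.span_neg fun_space.span_sum fun_space.span_scale
        fun_space.span_base) auto
  have "v i \<in> fun_space.span (v ` (I - {j}))" if "i \<in> I" for i
    using that vj by (cases "i = j") (auto intro: fun_space.span_base)
  then show ?thesis by blast
qed

lemma hdim_ge:
  assumes B: "fun_space.independent B" "finite B" "B \<subseteq> V"
  shows "enat (card B) \<le> hdim V"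
proof (cases "\<exists>C. finite C \<and> V \<subseteq> fun_space.span C")
  case True
  then obtain C where C: "finite C" "V \<subseteq> fun_space.span C" by blast
  obtain B' where B': "B' \<subseteq> V" "fun_space.independent B'" "V \<subseteq> fun_space.span B'"
    "card B' = fun_space.dim V"
    using fun_space.basis_exists[of V] by blast
  have "finite B'"
    using fun_space.independent_span_bound[OF C(1) B'(2)] B'(1) C(2) by blast
  then have "card B \<le> card B'"
    using fun_space.independent_span_bound[OF _ B(1), of B'] B(3) B'(3) by blast
  then show ?thesis using B'(4) True by (simp add: hdim_def)
qed (auto simp: hdim_def)

lemma hdim_le:
  assumes "V \<subseteq> fun_space.span B" "finite B"
  shows "hdim V \<le> enat (card B)"
  using assms fun_space.dim_le_card[of V B] by (auto simp: hdim_def)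

lemma (in hilbert_function_space) hclosure_superset: "A \<subseteq> H \<Longrightarrow> A \<subseteq> hclosure H ip A"
proof
  fix f assume "A \<subseteq> H" "f \<in> A"
  moreover have "hnorm ip (f - f) = 0" by simp
  ultimately show "f \<in> hclosure H ip A" unfolding hclosure_def by force
qed

section \<open>Defect ranges of submodules with polynomial projections\<close>

text \<open>\<open>S_hilbert\<close> and \<open>S_bounded\<close> are contained in the definition of
  maximality and are supplied from there; they provide the adjoints inside \<open>S\<close>.\<close>

locale poly_submodule = drury_arveson_space H ip
  for H :: "(complex ^ 'd::finite \<Rightarrow> complex) set"
    and ip :: "(complex ^ 'd \<Rightarrow> complex) \<Rightarrow> (complex ^ 'd \<Rightarrow> complex) \<Rightarrow> complex" +
  fixes S :: "(complex ^ 'd \<Rightarrow> complex) set"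
    and I :: "nat set"
    and p :: "nat \<Rightarrow> 'd cpoly"
  assumes submodule: "submodule H ip S"
    and S_hilbert: "hilbert_function_space S ip"
    and S_bounded: "bounded_operator S ip (coord_shift i)"
    and finite_I: "finite I"
    and projection: "f \<in> H \<Longrightarrow> hprojection ip S f =
      (\<Sum>i\<in>I. mult_op (poly_fun (p i)) (hadjoint H ip (mult_op (poly_fun (p i))) f))"
begin

sublocale S: hilbert_function_space S ip
  by (rule S_hilbert)

lemma S_subset: "S \<subseteq> H" and shift_mem: "f \<in> S \<Longrightarrow> coord_shift i f \<in> S"
  using submodule by (auto simp: submodule_def closed_subspace_def image_subset_iff)

lemma S_in_H: "f \<in> S \<Longrightarrow> f \<in> H"
  using S_subset by blast

text \<open>\<open>K 0\<close> is the constant 1 on the ball, so this is the polynomial as an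
  element of \<open>H\<close>, cut off outside the ball.\<close>

definition P :: "nat \<Rightarrow> complex ^ 'd \<Rightarrow> complex"
  where "P i = mult_op (poly_fun (p i)) (K 0)"

lemma P_mem: "P i \<in> H"
  unfolding P_def by (intro multiplier_mem multiplier_poly_fun K_mem) simp

lemma P_apply: "z \<in> D \<Longrightarrow> P i z = poly_fun (p i) z"
  by (simp add: P_def mult_op_def K_0)

lemma P_outside: "z \<notin> D \<Longrightarrow> P i z = 0"
  by (simp add: P_def mult_op_def K_outside)

text \<open>The reproducing kernel of \<open>S\<close>: kernel functions are eigenvectors of adjoint
  multipliers, so the hypothesis on the projection turns P_S K_w into this sum for w in the
  ball.\<close>

definition kS :: "complex ^ 'd \<Rightarrow> complex ^ 'd \<Rightarrow> complex"
  where "kS w = (\<Sum>i\<in>I. cscale (cnj (P i w)) (mult_op (P i) (K w)))"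

lemma kS_apply: "kS w z = (\<Sum>i\<in>I. cnj (P i w) * P i z) * K w z"
  by (simp add: kS_def sum_fun_apply mult_op_def sum_distrib_right mult.assoc)

lemma hprojection_K:
  assumes w: "w \<in> D"
  shows "hprojection ip S (K w) = kS w"
proof
  fix z
  have "hprojection ip S (K w) z = (\<Sum>i\<in>I. poly_fun (p i) z * (cnj (poly_fun (p i) w) * K w z))"
    using w by (simp add: projection hadjoint_multiplier_K multiplier_poly_fun sum_fun_apply mult_op_def)
  also have "\<dots> = kS w z"
    using w by (cases "z \<in> D")
      (auto simp: kS_apply P_apply K_outside sum_distrib_left mult_ac intro!: sum.cong)
  finally show "hprojection ip S (K w) z = kS w z" .
qed

lemma kS_mem: "w \<in> D \<Longrightarrow> kS w \<in> S"
  using hprojection_mem[OF S_subset S_hilbert K_mem] hprojection_K by metis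

lemma ip_kS: "w \<in> D \<Longrightarrow> f \<in> S \<Longrightarrow> ip f (kS w) = f w"
  using hprojection_ip[OF S_subset S_hilbert K_mem] hprojection_K ip_K S_in_H by metis

lemma S_eqI: "\<lbrakk>f \<in> S; g \<in> S; \<And>h. h \<in> S \<Longrightarrow> ip h f = ip h g\<rbrakk> \<Longrightarrow> f = g"
  by (rule S.eqI_ip)

lemma mult_bip_eq:
  "mult_op (\<lambda>z. bip z w) f = (\<Sum>j\<in>UNIV. cscale (cnj (w $ j)) (coord_shift j f))"
  by (auto simp: fun_eq_iff sum_fun_apply mult_op_def bip_def coord_shift_def sum_distrib_left
      sum_distrib_right mult_ac)

lemma mult_bip_mem_S: "f \<in> S \<Longrightarrow> mult_op (\<lambda>z. bip z w) f \<in> S"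
  unfolding mult_bip_eq by (intro S.mem_sum S.mem_scale shift_mem)

lemma mult_bip_power_Suc:
  "mult_op (\<lambda>z. bip z w ^ Suc k) f = mult_op (\<lambda>z. bip z w) (mult_op (\<lambda>z. bip z w ^ k) f)"
  by (auto simp: mult_op_def)

lemma mult_bip_power_mem_S: "f \<in> S \<Longrightarrow> mult_op (\<lambda>z. bip z w ^ k) f \<in> S"
proof (induction k)
  case 0
  then show ?case by (simp add: mult_op_def)
next
  case (Suc k)
  then show ?case unfolding mult_bip_power_Suc by (intro mult_bip_mem_S)
qed

text \<open>The defect operator I - \<Psi>(I) of \<open>S\<close> applied to
  \<open>kS w\<close>.\<close>

definition E :: "complex ^ 'd \<Rightarrow> complex ^ 'd \<Rightarrow> complex"
  where "E w = (\<Sum>i\<in>I. cscale (cnj (P i w)) (P i))"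

lemma E_eq:
  assumes w: "w \<in> D"
  shows "E w = kS w - mult_op (\<lambda>z. bip z w) (kS w)"
proof
  fix z
  show "E w z = (kS w - mult_op (\<lambda>z. bip z w) (kS w)) z"
  proof (cases "z \<in> D")
    case True
    have K1: "K w z - bip z w * K w z = 1"
      using K_recursion[OF True w] by (metis add_diff_cancel_right')
    have "(kS w - mult_op (\<lambda>z. bip z w) (kS w)) z
        = (\<Sum>i\<in>I. cnj (P i w) * P i z) * (K w z - bip z w * K w z)"
      by (simp add: mult_op_def kS_apply algebra_simps)
    then show ?thesis
      unfolding K1 by (simp add: E_def sum_fun_apply)
  next
    case False
    then show ?thesis by (simp add: E_def sum_fun_apply mult_op_def kS_apply K_outside P_outside)
  qed
qed

lemma E_mem: "w \<in> D \<Longrightarrow> E w \<in> S"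
  unfolding E_eq by (intro S.mem_diff kS_mem mult_bip_mem_S)

text \<open>The generators are recovered from the defect vectors, even if they are linearly
  dependent. This yields both that each \<open>P i\<close> lies in \<open>S\<close> and that
  \<open>Delta\<close> at 1 is at least their rank.\<close>

lemma E_basis:
  obtains B where "finite B" "B \<subseteq> E ` D" "fun_space.independent B" "fun_space.span B = fun_space.span (P ` I)"
proof -
  obtain B where B: "B \<subseteq> E ` D" "fun_space.independent B" "E ` D \<subseteq> fun_space.span B"
    using fun_space.maximal_independent_subset[of "E ` D"] by blast
  have "E w \<in> fun_space.span (P ` I)" for w
    unfolding E_def
    by (intro fun_space.span_sum fun_space.span_scale fun_space.span_base imageI)
  then have E_span: "E ` D \<subseteq> fun_space.span (P ` I)" by blast
  have fin: "finite B"
    using fun_space.independent_span_bound[OF _ B(2), of "P ` I"] finite_I B(1) E_span by blast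
  have BH: "B \<subseteq> H" using B(1) E_mem S_in_H by blast
  have "P j \<in> fun_space.span B" if j: "j \<in> I" for j
  proof -
    obtain g where g: "g \<in> fun_space.span B" "\<forall>b\<in>fun_space.span B. ip (P j - g) b = 0"
      using finite_span_projection[OF fin BH P_mem] by blast
    have gH: "g \<in> H" using g(1) span_subset[OF BH] by blast
    \<comment> \<open>The residual is orthogonal to every \<open>E w\<close>. Written out, this says
      that the function \<Sum>_i <h, P_i> P_i vanishes on the ball.\<close>
    define h where "h = P j - g"
    have h: "h \<in> H" unfolding h_def using P_mem gH by (rule mem_diff)
    have comb: "(\<Sum>i\<in>I. cscale (ip h (P i)) (P i)) = 0"
    proof
      fix w
      show "(\<Sum>i\<in>I. cscale (ip h (P i)) (P i)) w = 0 w"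
      proof (cases "w \<in> D")
        case True
        then have "ip h (E w) = 0" using g(2) B(3) unfolding h_def by blast
        also have "ip h (E w) = (\<Sum>i\<in>I. ip h (P i) * P i w)"
          unfolding E_def using h P_mem
          by (subst ip_sum_right) (auto simp: ip_scale_right mult.commute)
        finally show ?thesis by (simp add: sum_fun_apply)
      next
        case False
        then show ?thesis by (simp add: sum_fun_apply P_outside)
      qed
    qed
    \<comment> \<open>Pairing the vanishing function with \<open>h\<close> itself produces a sum of
      squares, so every <h, P_i> is 0.\<close>
    have "0 = ip (\<Sum>i\<in>I. cscale (ip h (P i)) (P i)) h"
      using comb h by simp
    also have "\<dots> = (\<Sum>i\<in>I. ip h (P i) * ip (P i) h)"
      using h P_mem by (subst ip_sum_left) (auto simp: ip_scale_left)
    also have "\<dots> = (\<Sum>i\<in>I. of_real ((cmod (ip h (P i)))\<^sup>2))"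
      by (intro sum.cong refl) (simp only: ip_commute[OF h P_mem] complex_norm_square)
    finally have "complex_of_real (\<Sum>i\<in>I. (cmod (ip h (P i)))\<^sup>2) = 0"
      by simp
    then have "(\<Sum>i\<in>I. (cmod (ip h (P i)))\<^sup>2) = 0" by (simp only: of_real_eq_0_iff)
    then have "(cmod (ip h (P j)))\<^sup>2 = 0"
      using j finite_I by (subst (asm) sum_nonneg_eq_0_iff) auto
    moreover have "ip h g = 0" using g unfolding h_def by blast
    ultimately have "ip h h = 0"
      using h P_mem gH ip_diff_right[of "P j" g h] unfolding h_def[symmetric] by simp
    then have "h = 0" using h ip_definite by blast
    then show ?thesis using g(1) by (simp add: h_def)
  qed
  then have "fun_space.span (P ` I) \<subseteq> fun_space.span B"
    by (intro fun_space.span_minimal fun_space.subspace_span) blast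
  moreover have "fun_space.span B \<subseteq> fun_space.span (P ` I)"
    using B(1) E_span by (intro fun_space.span_minimal fun_space.subspace_span) blast
  ultimately show ?thesis using that[OF fin B(1,2)] by blast
qed

lemma P_mem_S:
  assumes "i \<in> I"
  shows "P i \<in> S"
proof -
  obtain B where B: "B \<subseteq> E ` D" "fun_space.span B = fun_space.span (P ` I)"
    by (rule E_basis)
  have "fun_space.span B \<subseteq> S"
    using B(1) E_mem by (intro S.span_subset) blast
  moreover have "P i \<in> fun_space.span (P ` I)"
    using assms by (intro fun_space.span_base) blast
  ultimately show ?thesis using B(2) by blast
qed

section \<open>The range of I - \<Psi>^n(I)\<close>

abbreviation A :: "'d \<Rightarrow> (complex ^ 'd \<Rightarrow> complex) \<Rightarrow> complex ^ 'd \<Rightarrow> complex"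
  where "A i \<equiv> hadjoint S ip (coord_shift i)"

abbreviation X :: "nat \<Rightarrow> (complex ^ 'd \<Rightarrow> complex) \<Rightarrow> complex ^ 'd \<Rightarrow> complex"
  where "X k \<equiv> (Psi S ip (coord_shift :: 'd \<Rightarrow> _) ^^ k) id"

lemma A_mem: "f \<in> S \<Longrightarrow> A i f \<in> S"
  by (rule S.hadjoint_mem[OF S_bounded])

lemma ip_A: "f \<in> S \<Longrightarrow> g \<in> S \<Longrightarrow> ip (coord_shift i f) g = ip f (A i g)"
  by (rule S.hadjoint_ip[OF S_bounded])

lemma ip_A': "f \<in> S \<Longrightarrow> g \<in> S \<Longrightarrow> ip g (coord_shift i f) = ip (A i g) f"
  using ip_A[of f g i] S.ip_commute[of "coord_shift i f" g] S.ip_commute[of f "A i g"] A_mem shift_mem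
  by simp

lemma X_Suc: "X (Suc k) f = (\<Sum>i\<in>UNIV. coord_shift i (X k (A i f)))"
  by (simp add: Psi_def)

lemma X_mem: "f \<in> S \<Longrightarrow> X k f \<in> S"
proof (induction k arbitrary: f)
  case 0
  then show ?case by simp
next
  case (Suc k)
  then show ?case unfolding X_Suc by (intro S.mem_sum shift_mem Suc.IH A_mem)
qed

lemma X_selfadjoint: "f \<in> S \<Longrightarrow> g \<in> S \<Longrightarrow> ip (X k f) g = ip f (X k g)"
proof (induction k arbitrary: f g)
  case 0
  then show ?case by simp
next
  case (Suc k)
  have "ip (X (Suc k) f) g = (\<Sum>i\<in>UNIV. ip (coord_shift i (X k (A i f))) g)"
    unfolding X_Suc using Suc.prems by (intro S.ip_sum_left shift_mem X_mem A_mem)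
  also have "\<dots> = (\<Sum>i\<in>UNIV. ip (A i f) (X k (A i g)))"
    using Suc by (intro sum.cong refl) (simp only: ip_A X_mem A_mem)
  also have "\<dots> = (\<Sum>i\<in>UNIV. ip f (coord_shift i (X k (A i g))))"
    using Suc.prems by (intro sum.cong refl) (simp only: ip_A' X_mem A_mem)
  also have "\<dots> = ip f (X (Suc k) g)"
    unfolding X_Suc using Suc.prems by (intro S.ip_sum_right[symmetric] shift_mem X_mem A_mem)
  finally show ?case .
qed

text \<open>Symmetry gives homogeneity: once \<open>X k\<close> is moved to the other argument, the
  scalar comes out.\<close>

lemma X_cscale:
  assumes f: "f \<in> S"
  shows "X k (cscale c f) = cscale c (X k f)"
proof (rule S_eqI)
  have cf: "cscale c f \<in> S" using f by (rule S.mem_scale)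
  show "X k (cscale c f) \<in> S" using cf by (rule X_mem)
  show "cscale c (X k f) \<in> S" using f by (intro S.mem_scale X_mem)
  fix h assume h: "h \<in> S"
  show "ip h (X k (cscale c f)) = ip h (cscale c (X k f))"
    using X_selfadjoint[OF h cf, of k] X_selfadjoint[OF h f, of k] S.ip_scale_right f h X_mem
    by metis
qed

lemma A_kS:
  assumes w: "w \<in> D"
  shows "A i (kS w) = cscale (cnj (w $ i)) (kS w)"
proof (rule S.hadjoint_eqI)
  show "cscale (cnj (w $ i)) (kS w) \<in> S" using w by (intro S.mem_scale kS_mem)
  fix f assume f: "f \<in> S"
  then have "ip (coord_shift i f) (kS w) = w $ i * f w"
    using w by (simp add: ip_kS shift_mem) (simp add: coord_shift_def mult_op_def)
  also have "\<dots> = ip f (cscale (cnj (w $ i)) (kS w))"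
    using w f by (simp add: S.ip_scale_right kS_mem ip_kS)
  finally show "ip (coord_shift i f) (kS w) = ip f (cscale (cnj (w $ i)) (kS w))" .
qed

text \<open>\<open>kS w\<close> is a joint eigenvector of the adjoint tuple, so each application of
  \<Psi> multiplies by one more factor \<Sum>_i z_i conj(w_i).\<close>

lemma X_kS:
  assumes w: "w \<in> D"
  shows "X k (kS w) = mult_op (\<lambda>z. bip z w ^ k) (kS w)"
proof (induction k)
  case 0
  then show ?case by (simp add: mult_op_def)
next
  case (Suc k)
  have "X (Suc k) (kS w) = (\<Sum>i\<in>UNIV. coord_shift i (cscale (cnj (w $ i)) (X k (kS w))))"
    unfolding X_Suc A_kS[OF w] using w by (simp only: X_cscale kS_mem)
  also have "\<dots> = mult_op (\<lambda>z. bip z w) (X k (kS w))"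
    unfolding mult_bip_eq coord_shift_def mult_op_cscale ..
  finally show ?case unfolding Suc.IH mult_bip_power_Suc .
qed

text \<open>The factor 1/(1 - bip z w) of the kernel turns 1 - (bip z w)^n into a finite geometric
  sum, so only polynomial expressions remain.\<close>

lemma kS_minus_X_kS:
  assumes w: "w \<in> D"
  shows "kS w - X n (kS w) = (\<Sum>k<n. \<Sum>i\<in>I. cscale (cnj (P i w)) (mult_op (\<lambda>z. bip z w ^ k) (P i)))"
proof
  fix z
  show "(kS w - X n (kS w)) z
      = (\<Sum>k<n. \<Sum>i\<in>I. cscale (cnj (P i w)) (mult_op (\<lambda>z. bip z w ^ k) (P i))) z"
  proof (cases "z \<in> D")
    case True
    let ?s = "\<Sum>i\<in>I. cnj (P i w) * P i z"
    have "(kS w - X n (kS w)) z = ?s * ((1 - bip z w ^ n) / (1 - bip z w))"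
      using True by (simp add: X_kS[OF w] mult_op_def kS_apply K_eq) (simp add: diff_divide_distrib algebra_simps)
    also have "(1 - bip z w ^ n) / (1 - bip z w) = (\<Sum>k<n. bip z w ^ k)"
      using bip_neq_1[OF True w] by (simp add: sum_gp_strict)
    also have "?s * (\<Sum>k<n. bip z w ^ k) = (\<Sum>k<n. \<Sum>i\<in>I. cnj (P i w) * P i z * bip z w ^ k)"
      by (subst sum.swap) (simp add: sum_product)
    also have "\<dots> = (\<Sum>k<n. \<Sum>i\<in>I. cscale (cnj (P i w)) (mult_op (\<lambda>z. bip z w ^ k) (P i))) z"
      by (simp add: sum_fun_apply mult_op_def mult_ac)
    finally show ?thesis .
  next
    case False
    then show ?thesis
      by (simp add: X_kS[OF w] mult_op_def sum_fun_apply kS_apply K_outside P_outside)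
  qed
qed

text \<open>Evaluation at \<open>w\<close> is pairing with \<open>kS w\<close>, and symmetry moves
  the defect operator onto \<open>kS w\<close>, where it is explicit.\<close>

lemma minus_X_apply:
  assumes f: "f \<in> S" and w: "w \<in> D"
  shows "(f - X n f) w = (\<Sum>k<n. \<Sum>i\<in>I. P i w * ip f (mult_op (\<lambda>z. bip z w ^ k) (P i)))"
proof -
  have mem: "mult_op (\<lambda>z. bip z w ^ k) (P i) \<in> S" if "i \<in> I" for i k
    using that by (intro mult_bip_power_mem_S P_mem_S)
  have "(f - X n f) w = ip f (kS w) - ip (X n f) (kS w)"
    using f w by (simp only: fun_diff_def ip_kS X_mem)
  also have "\<dots> = ip f (kS w - X n (kS w))"
    using f w by (simp only: X_selfadjoint kS_mem S.ip_diff_right X_mem)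
  also have "\<dots> = (\<Sum>k<n. ip f (\<Sum>i\<in>I. cscale (cnj (P i w)) (mult_op (\<lambda>z. bip z w ^ k) (P i))))"
    unfolding kS_minus_X_kS[OF w] using f mem by (intro S.ip_sum_right S.mem_sum S.mem_scale)
  also have "\<dots> = (\<Sum>k<n. \<Sum>i\<in>I. ip f (cscale (cnj (P i w)) (mult_op (\<lambda>z. bip z w ^ k) (P i))))"
    using f mem by (intro sum.cong refl S.ip_sum_right S.mem_scale)
  also have "\<dots> = (\<Sum>k<n. \<Sum>i\<in>I. P i w * ip f (mult_op (\<lambda>z. bip z w ^ k) (P i)))"
    using f mem by (intro sum.cong refl) (simp add: S.ip_scale_right)
  finally show ?thesis .
qed

text \<open>The second argument is conjugate linear, so conj(w_j) inside becomes w_j outside and the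
  result is a homogeneous polynomial of degree k in w. Each induction step absorbs a coordinate
  shift into \<open>a\<close>, hence the generalisation over \<open>a\<close>.\<close>

lemma ip_mult_bip_span:
  "f \<in> S \<Longrightarrow> a \<in> S \<Longrightarrow>
    (\<lambda>w. ip f (mult_op (\<lambda>z. bip z w ^ k) a)) \<in> fun_space.span (mon ` exps k)"
proof (induction k arbitrary: a)
  case 0
  have "mon (\<lambda>_. 0) \<in> fun_space.span (mon ` exps 0)"
    by (intro fun_space.span_base imageI) (simp add: exps_def)
  then have "cscale (ip f a) (mon (\<lambda>_. 0)) \<in> fun_space.span (mon ` exps 0)"
    by (rule fun_space.span_scale)
  moreover have "(\<lambda>w. ip f (mult_op (\<lambda>z. bip z w ^ 0) a)) = cscale (ip f a) (mon (\<lambda>_. 0))"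
    by (auto simp: mon_def mult_op_def fun_eq_iff)
  ultimately show ?case by metis
next
  case (Suc k)
  let ?\<phi> = "\<lambda>j w. ip f (mult_op (\<lambda>z. bip z w ^ k) (coord_shift j a))"
  have "(\<lambda>w. ip f (mult_op (\<lambda>z. bip z w ^ Suc k) a)) = (\<Sum>j\<in>UNIV. coord_shift j (?\<phi> j))"
  proof
    fix w
    have eq: "mult_op (\<lambda>z. bip z w ^ Suc k) a
        = (\<Sum>j\<in>UNIV. cscale (cnj (w $ j)) (mult_op (\<lambda>z. bip z w ^ k) (coord_shift j a)))"
      by (auto simp: fun_eq_iff sum_fun_apply mult_op_def bip_def coord_shift_def sum_distrib_left
          sum_distrib_right mult_ac)
    have "ip f (mult_op (\<lambda>z. bip z w ^ Suc k) a) = (\<Sum>j\<in>UNIV. w $ j * ?\<phi> j w)"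
      unfolding eq using Suc.prems
      by (subst S.ip_sum_right)
        (auto simp: S.ip_scale_right mult_bip_power_mem_S shift_mem)
    then show "ip f (mult_op (\<lambda>z. bip z w ^ Suc k) a) = (\<Sum>j\<in>UNIV. coord_shift j (?\<phi> j)) w"
      by (simp add: sum_fun_apply coord_shift_def mult_op_def)
  qed
  moreover have "coord_shift j (?\<phi> j) \<in> fun_space.span (mon ` exps (Suc k))" for j
  proof -
    have "mult_op (\<lambda>z. z $ j) (?\<phi> j) \<in> fun_space.span (mult_op (\<lambda>z. z $ j) ` mon ` exps k)"
      using Suc.prems by (intro mult_op_span Suc.IH shift_mem)
    moreover have "mult_op (\<lambda>z. z $ j) ` mon ` exps k \<subseteq> mon ` exps (Suc k)"
    proof (clarify)
      fix \<alpha> :: "'d \<Rightarrow> nat" assume "\<alpha> \<in> exps k"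
      moreover have "mult_op (\<lambda>z. z $ j) (mon \<alpha>) = mon (\<alpha>(j := Suc (\<alpha> j)))"
        by (rule ext) (simp add: mult_op_def mon_step)
      ultimately show "mult_op (\<lambda>z. z $ j) (mon \<alpha>) \<in> mon ` exps (Suc k)"
        using exps_step by blast
    qed
    ultimately show ?thesis
      unfolding coord_shift_def using fun_space.span_mono by blast
  qed
  ultimately show ?case by (simp only: fun_space.span_sum)
qed

text \<open>Passing from the generators to any \<open>B\<close> with the same span lets the later
  count depend on their rank instead of their number.\<close>

lemma minus_X_span:
  assumes f: "f \<in> S" and B: "fun_space.span B = fun_space.span (P ` I)"
  shows "f - X n f \<in> fun_space.span ((\<lambda>(\<alpha>, b). mult_op (mon \<alpha>) b) ` (exps_less n \<times> B))"
    (is "_ \<in> fun_space.span ?F")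
proof -
  let ?\<phi> = "\<lambda>k i w. ip f (mult_op (\<lambda>z. bip z w ^ k) (P i))"
  have "f - X n f = (\<Sum>k<n. \<Sum>i\<in>I. mult_op (P i) (?\<phi> k i))"
  proof
    fix w
    show "(f - X n f) w = (\<Sum>k<n. \<Sum>i\<in>I. mult_op (P i) (?\<phi> k i)) w"
    proof (cases "w \<in> D")
      case True
      then show ?thesis
        by (subst minus_X_apply[OF f True]) (simp add: sum_fun_apply mult_op_def)
    next
      case False
      have "f - X n f \<in> H" using f X_mem S_in_H by blast
      then have "(f - X n f) w = 0" using False by (rule vanishes_outside)
      moreover have "P i w = 0" for i using False by (rule P_outside)
      ultimately show ?thesis by (simp add: sum_fun_apply mult_op_def)
    qed
  qed
  moreover have "mult_op (P i) (?\<phi> k i) \<in> fun_space.span ?F" if k: "k < n" and i: "i \<in> I" for k i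
  proof -
    have "mult_op (P i) (?\<phi> k i) \<in> fun_space.span (mult_op (P i) ` mon ` exps k)"
      using f i by (intro mult_op_span ip_mult_bip_span P_mem_S)
    moreover have "mult_op (P i) ` mon ` exps k \<subseteq> fun_space.span ?F"
    proof clarify
      fix \<alpha> :: "'d \<Rightarrow> nat" assume \<alpha>: "\<alpha> \<in> exps k"
      have "P i \<in> fun_space.span B" unfolding B using i by (intro fun_space.span_base) blast
      then have "mult_op (mon \<alpha>) (P i) \<in> fun_space.span (mult_op (mon \<alpha>) ` B)"
        by (rule mult_op_span)
      moreover have "mult_op (mon \<alpha>) ` B \<subseteq> ?F"
        using \<alpha> k by (force simp: exps_def exps_less_def)
      moreover have "mult_op (P i) (mon \<alpha>) = mult_op (mon \<alpha>) (P i)"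
        by (auto simp: mult_op_def fun_eq_iff)
      ultimately show "mult_op (P i) (mon \<alpha>) \<in> fun_space.span ?F"
        using fun_space.span_mono[of "mult_op (mon \<alpha>) ` B" ?F] by auto
    qed
    ultimately show ?thesis
      using fun_space.span_minimal[OF _ fun_space.subspace_span] by blast
  qed
  ultimately show ?thesis by (auto intro!: fun_space.span_sum)
qed

end

section \<open>Bounds for \<open>Delta\<close> and the rank of the generators\<close>

context poly_submodule
begin

lemma mult_mon_mem_S:
  assumes "f \<in> S"
  shows "mult_op (mon \<alpha>) f \<in> S"
proof -
  let ?R = "\<lambda>\<phi>. \<forall>f\<in>S. mult_op \<phi> f \<in> S"
  have mult: "?R (\<lambda>z. \<phi> z * \<psi> z)" if "?R \<phi>" "?R \<psi>" for \<phi> \<psi>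
  proof
    fix f assume "f \<in> S"
    then have "mult_op \<phi> (mult_op \<psi> f) \<in> S" using that by blast
    then show "mult_op (\<lambda>z. \<phi> z * \<psi> z) f \<in> S" by (simp add: mult_op_def mult.assoc)
  qed
  have one: "?R (\<lambda>_. 1)" by (simp add: mult_op_def)
  have coord: "?R (\<lambda>z. z $ i)" for i using shift_mem by (simp add: coord_shift_def)
  have power: "?R (\<lambda>z. (z $ i) ^ k)" for i k
    by (induction k) (use one coord[of i] mult in \<open>simp_all\<close>)
  have "?R (\<lambda>z. \<Prod>i\<in>A. (z $ i) ^ \<alpha> i)" if "finite A" for A
    using that by (induction A rule: finite_induct) (use one power mult in \<open>simp_all\<close>)
  from this[of UNIV] show ?thesis using assms by (simp add: mon_def[abs_def])
qed

text \<open>The vectors \<open>E w\<close> lie in the range of the defect operator, and they contain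
  a basis of the span of the generators; any other basis has the same cardinality.\<close>

lemma Delta_ge:
  assumes B: "finite B" "fun_space.independent B" "fun_space.span B = fun_space.span (P ` I)"
  shows "enat (card B) \<le> Delta S ip (coord_shift :: 'd \<Rightarrow> _) 1"
proof -
  let ?R = "(\<lambda>f. f - X 1 f) ` S"
  obtain B' where B': "finite B'" "B' \<subseteq> E ` D" "fun_space.independent B'"
    "fun_space.span B' = fun_space.span (P ` I)"
    by (rule E_basis)
  have "card B = card B'"
    using fun_space.dim_span_eq_card_independent[OF B(2)]
      fun_space.dim_span_eq_card_independent[OF B'(3)] B(3) B'(4) by simp
  moreover have "E w \<in> ?R" if w: "w \<in> D" for w
  proof -
    have "E w = kS w - X 1 (kS w)" using w by (simp only: E_eq X_kS power_one_right)
    then show ?thesis using kS_mem[OF w] by blast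
  qed
  then have "B' \<subseteq> ?R" using B'(2) by blast
  moreover have "?R \<subseteq> hclosure S ip ?R"
    by (intro S.hclosure_superset image_subsetI S.mem_diff X_mem)
  ultimately show ?thesis
    unfolding Delta_def using hdim_ge[OF B'(3,1), of "hclosure S ip ?R"] by (simp only:)
qed

lemma Delta_le:
  assumes F: "finite F" "F \<subseteq> S" "\<And>f. f \<in> S \<Longrightarrow> f - X n f \<in> fun_space.span F"
  shows "Delta S ip (coord_shift :: 'd \<Rightarrow> _) n \<le> enat (card F)"
  unfolding Delta_def
  by (intro hdim_le S.hclosure_span_subset image_subsetI F)

text \<open>Two independent generators satisfy the relation \<open>P i2 * P i1 - P i1 * P i2 = 0\<close>, which
  makes the spanning family of the range of \<open>I - \<Psi>^n(I)\<close> linearly dependent for large \<open>n\<close>.\<close>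

lemma maximal_rank_le_1:
  assumes max: "\<And>n. n \<ge> 1 \<Longrightarrow> Delta S ip (coord_shift :: 'd \<Rightarrow> _) n =
      enat (\<Sum>k<n. (k + CARD('d) - 1) choose (CARD('d) - 1)) * Delta S ip (coord_shift :: 'd \<Rightarrow> _) 1"
    and B: "fun_space.independent B" "B \<subseteq> P ` I" "fun_space.span B = fun_space.span (P ` I)"
    and b: "b1 \<in> B" "b2 \<in> B"
  shows "b1 = b2"
proof (rule ccontr)
  assume neq: "b1 \<noteq> b2"
  have fin: "finite B" using B(2) finite_I finite_subset by blast
  have BS: "B \<subseteq> S" using B(2) P_mem_S by blast
  obtain i1 i2 where i: "i1 \<in> I" "i2 \<in> I" "b1 = P i1" "b2 = P i2" using b B(2) by blast
  obtain N1 where N1: "\<And>n z. N1 \<le> n \<Longrightarrow> poly_fun (p i1) z = (\<Sum>\<alpha>\<in>exps_less n. pcoeff (p i1) \<alpha> * mon \<alpha> z)"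
    using poly_fun_eq_exps[of "p i1"] by blast
  obtain N2 where N2: "\<And>n z. N2 \<le> n \<Longrightarrow> poly_fun (p i2) z = (\<Sum>\<alpha>\<in>exps_less n. pcoeff (p i2) \<alpha> * mon \<alpha> z)"
    using poly_fun_eq_exps[of "p i2"] by blast
  \<comment> \<open>Both generators must have degree below \<open>n\<close> for the relation to live
    inside the family; maximality speaks of n \<ge> 1 only.\<close>
  define n where "n = max 1 (max N1 N2)"
  have n: "1 \<le> n" "N1 \<le> n" "N2 \<le> n" by (auto simp: n_def)
  let ?J = "(exps_less n :: ('d \<Rightarrow> nat) set) \<times> B"
  let ?v = "\<lambda>(\<alpha>, b). mult_op (mon \<alpha>) b :: complex ^ 'd \<Rightarrow> complex"
  \<comment> \<open>The relation p_{i2} b1 - p_{i1} b2 = 0 expanded in monomials: \<open>b1\<close>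
    carries the coefficients of the second polynomial, \<open>b2\<close> minus those of the
    first.\<close>
  let ?u = "\<lambda>(\<alpha>, b). (if b = b1 then pcoeff (p i2) \<alpha> else 0) - (if b = b2 then pcoeff (p i1) \<alpha> else 0)"
  have finJ: "finite ?J" using fin finite_exps_less by blast
  have rel: "(\<Sum>x\<in>?J. cscale (?u x) (?v x)) = 0"
  proof
    fix z
    have inner: "(\<Sum>c\<in>B. ((if c = b1 then s else 0) - (if c = b2 then t else 0)) * (m * c z))
        = s * (m * b1 z) - t * (m * b2 z)" for s t m :: complex
      using fin b by (simp add: left_diff_distrib sum_subtractf if_distrib[of "\<lambda>x. x * _"] sum.delta
          cong: if_cong)
    have "(\<Sum>x\<in>?J. cscale (?u x) (?v x)) z = (\<Sum>x\<in>?J. ?u x * ?v x z)"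
      by (simp add: sum_fun_apply)
    also have "\<dots> = (\<Sum>\<alpha>\<in>exps_less n. \<Sum>c\<in>B. ?u (\<alpha>, c) * ?v (\<alpha>, c) z)"
      unfolding sum.cartesian_product by (intro sum.cong) auto
    also have "\<dots> = (\<Sum>\<alpha>\<in>exps_less n. pcoeff (p i2) \<alpha> * (mon \<alpha> z * b1 z) - pcoeff (p i1) \<alpha> * (mon \<alpha> z * b2 z))"
      by (simp only: prod.case mult_op_def inner)
    also have "\<dots> = (\<Sum>\<alpha>\<in>exps_less n. pcoeff (p i2) \<alpha> * mon \<alpha> z) * b1 z
        - (\<Sum>\<alpha>\<in>exps_less n. pcoeff (p i1) \<alpha> * mon \<alpha> z) * b2 z"
      by (simp add: sum_subtractf sum_distrib_right mult.assoc)
    also have "\<dots> = poly_fun (p i2) z * b1 z - poly_fun (p i1) z * b2 z"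
      by (simp only: N1[OF n(2)] N2[OF n(3)])
    also have "\<dots> = 0"
      unfolding i by (cases "z \<in> D") (simp_all add: P_apply P_outside)
    finally show "(\<Sum>x\<in>?J. cscale (?u x) (?v x)) z = 0 z" by simp
  qed
  have "b1 \<noteq> 0" using B(1) b(1) fun_space.dependent_zero by blast
  have "\<exists>\<alpha>\<in>exps_less n. pcoeff (p i1) \<alpha> \<noteq> 0"
  proof (rule ccontr)
    assume "\<not> ?thesis"
    then have "poly_fun (p i1) z = 0" for z by (simp add: N1[OF n(2)])
    then have "b1 = 0" by (simp add: i P_def mult_op_def fun_eq_iff)
    with \<open>b1 \<noteq> 0\<close> show False by blast
  qed
  then obtain \<alpha> where \<alpha>: "\<alpha> \<in> exps_less n" "pcoeff (p i1) \<alpha> \<noteq> 0" by blast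
  let ?j = "(\<alpha>, b2)"
  have j: "?j \<in> ?J" "?u ?j \<noteq> 0" using \<alpha> b neq by auto
  let ?F = "?v ` (?J - {?j})"
  have sub: "?v ` ?J \<subseteq> fun_space.span ?F"
    by (rule dim_family_less[OF finJ rel j])
  have "Delta S ip (coord_shift :: 'd \<Rightarrow> _) n \<le> enat (card ?F)"
  proof (rule Delta_le)
    show "finite ?F" using finJ by blast
    show "?F \<subseteq> S" using BS mult_mon_mem_S by auto
    fix f assume "f \<in> S"
    then have "f - X n f \<in> fun_space.span (?v ` ?J)" using B(3) by (rule minus_X_span)
    then show "f - X n f \<in> fun_space.span ?F"
      using fun_space.span_minimal[OF sub fun_space.subspace_span] by blast
  qed
  also have "card ?F < card ?J"
  proof -
    have "card ?F \<le> card (?J - {?j})" using finJ by (intro card_image_le) simp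
    also have "\<dots> < card ?J" using finJ j(1) by (rule card_Diff1_less)
    finally show ?thesis .
  qed
  then have "enat (card ?F) < enat (card ?J)" by simp
  also have "card ?J = (\<Sum>k<n. (k + CARD('d) - 1) choose (CARD('d) - 1)) * card B"
    by (simp only: card_cartesian_product card_exps_less)
  also have "enat \<dots> = enat (\<Sum>k<n. (k + CARD('d) - 1) choose (CARD('d) - 1)) * enat (card B)"
    by simp
  also have "\<dots> \<le> enat (\<Sum>k<n. (k + CARD('d) - 1) choose (CARD('d) - 1)) * Delta S ip (coord_shift :: 'd \<Rightarrow> _) 1"
    using Delta_ge[OF fin B(1,3)] by (rule mult_left_mono) simp
  also have "\<dots> = Delta S ip (coord_shift :: 'd \<Rightarrow> _) n"
    using max[OF n(1)] by simp
  finally show False by simp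
qed

end

section \<open>The rank one case\<close>

context drury_arveson_space
begin

text \<open>For w = t e_i the recursion for \<open>K w\<close> gives t = <z_i, K_w> = t <z_i, z_i
  K_w>. Hence 1 \<le> |z_i| |K_w|, and |K_w|^2 = 1/(1 - t^2) tends to 1 as t tends to 0.\<close>

lemma coord_shift_K0_norm_ge: "1 \<le> (hnorm ip (coord_shift i (K 0)))\<^sup>2"
proof (rule field_le_epsilon)
  fix e :: real assume e: "0 < e"
  \<comment> \<open>The bound 1/2 keeps the point in the ball and gives t^2 \<le> t, so t^2 \<le>
    e.\<close>
  define t where "t = min (1/2) e"
  have t: "0 < t" "t < 1" "t\<^sup>2 \<le> e"
    using e mult_left_le[of t t] by (auto simp: t_def power2_eq_square min_def)
  let ?w = "axis i (complex_of_real t) :: complex ^ 'd"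
  have wi: "?w $ k = (if k = i then of_real t else 0)" for k by (simp add: axis_def)
  have "norm ?w = norm (complex_of_real t)"
    unfolding norm_eq_sqrt_inner inner_axis_axis by simp
  then have w: "?w \<in> D" using t by simp
  have bip: "bip z ?w = z $ i * of_real t" for z
    by (simp add: bip_def wi if_distrib if_distribR cong: if_cong)
  let ?Z = "coord_shift i (K 0)"
  have Z: "?Z \<in> H" by (intro coord_shift_mem K_mem) simp
  have eq: "K ?w = K 0 + cscale (of_real t) (coord_shift i (K ?w))"
  proof
    fix z
    show "K ?w z = (K 0 + cscale (of_real t) (coord_shift i (K ?w))) z"
    proof (cases "z \<in> D")
      case True
      then show ?thesis
        using K_recursion[OF True w] by (simp add: bip K_0 coord_shift_def mult_op_def mult_ac)
    next
      case False
      then show ?thesis by (simp add: K_outside coord_shift_def mult_op_def)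
    qed
  qed
  have memZw: "coord_shift i (K ?w) \<in> H" using w by (intro coord_shift_mem K_mem)
  have "of_real t = ip ?Z (K ?w)"
    using ip_K[OF Z w] w by (simp add: coord_shift_def mult_op_def K_0 wi)
  also have "\<dots> = ip ?Z (K 0) + ip ?Z (cscale (of_real t) (coord_shift i (K ?w)))"
    by (subst eq, rule ip_add_right) (use Z memZw in auto)
  also have "ip ?Z (K 0) = 0"
    using ip_K[OF Z, of 0] by (simp add: coord_shift_def mult_op_def)
  also have "ip ?Z (cscale (of_real t) (coord_shift i (K ?w))) = of_real t * ip ?Z (coord_shift i (K ?w))"
    using Z memZw by (simp add: ip_scale_right)
  finally have "ip ?Z (coord_shift i (K ?w)) = 1" using t by simp
  then have "1 \<le> hnorm ip ?Z * hnorm ip (coord_shift i (K ?w))"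
    using cauchy_schwarz[OF Z memZw] by simp
  also have "\<dots> \<le> hnorm ip ?Z * hnorm ip (K ?w)"
    using coord_shift_norm_le[OF K_mem[OF w]] Z by (intro mult_left_mono) auto
  finally have "1\<^sup>2 \<le> (hnorm ip ?Z * hnorm ip (K ?w))\<^sup>2"
    by (intro power_mono) auto
  moreover have "(hnorm ip (K ?w))\<^sup>2 = 1 / (1 - t\<^sup>2)"
  proof -
    have "complex_of_real ((hnorm ip (K ?w))\<^sup>2) = 1 / (1 - (of_real t * of_real t))"
      using ip_K[OF K_mem[OF w] w] K_eq[OF w, of ?w] w
      by (simp only: ip_self[OF K_mem[OF w], symmetric] bip) (simp add: wi)
    then have "complex_of_real ((hnorm ip (K ?w))\<^sup>2) = of_real (1 / (1 - t\<^sup>2))"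
      by (simp add: power2_eq_square)
    then show ?thesis by (simp only: of_real_eq_iff)
  qed
  ultimately have "1 \<le> (hnorm ip ?Z)\<^sup>2 / (1 - t\<^sup>2)"
    by (simp add: power_mult_distrib)
  moreover have "t\<^sup>2 < 1" using t power_strict_mono[of t 1 2] by simp
  ultimately have "1 - t\<^sup>2 \<le> (hnorm ip ?Z)\<^sup>2" by (simp add: field_simps)
  then show "1 \<le> (hnorm ip ?Z)\<^sup>2 + e" using t(3) by simp
qed

text \<open>Equality in the row contraction inequality at \<open>(0,\<dots>,q,\<dots>,0)\<close> is stable under perturbing
  the \<open>j\<close>-th entry only to first order, which forces orthogonality.\<close>

lemma norm_attained_orthogonal:
  assumes q: "q \<in> H" "hnorm ip q \<le> hnorm ip (coord_shift i q)" and ij: "i \<noteq> j" and f: "f \<in> H"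
  shows "ip (coord_shift i q) (coord_shift j f) = 0"
proof -
  define c where "c = ip (coord_shift i q) (coord_shift j f)"
  have mem: "coord_shift i q \<in> H" "coord_shift j f \<in> H" using q f coord_shift_mem by auto
  have "0 \<le> 2 * t * (- (cmod c)\<^sup>2) + t\<^sup>2 * ((cmod c)\<^sup>2 * (hnorm ip f)\<^sup>2)" for t
  proof -
    \<comment> \<open>The factor \<open>c\<close> aligns the phase, so that the cross term is the
      real number t |c|^2.\<close>
    let ?\<epsilon> = "of_real t * c"
    let ?F = "\<lambda>k. if k = i then q else if k = j then cscale ?\<epsilon> f else 0"
    have F: "\<And>k. ?F k \<in> H" using q f by auto
    have row: "(\<lambda>z. \<Sum>k\<in>UNIV. z $ k * ?F k z) = coord_shift i q + cscale ?\<epsilon> (coord_shift j f)"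
    proof
      fix z
      have "(\<Sum>k\<in>UNIV. z $ k * ?F k z)
          = (\<Sum>k\<in>UNIV. (if k = i then z $ k * q z else 0) + (if k = j then z $ k * (?\<epsilon> * f z) else 0))"
        using ij by (intro sum.cong) auto
      then show "(\<Sum>k\<in>UNIV. z $ k * ?F k z) = (coord_shift i q + cscale ?\<epsilon> (coord_shift j f)) z"
        by (simp add: sum.distrib coord_shift_def mult_op_def mult_ac)
    qed
    have "(\<Sum>k\<in>UNIV. (hnorm ip (?F k))\<^sup>2)
        = (\<Sum>k\<in>UNIV. (if k = i then (hnorm ip q)\<^sup>2 else 0) + (if k = j then (hnorm ip (cscale ?\<epsilon> f))\<^sup>2 else 0))"
      using ij by (intro sum.cong) auto
    also have "\<dots> = (hnorm ip q)\<^sup>2 + t\<^sup>2 * ((cmod c)\<^sup>2 * (hnorm ip f)\<^sup>2)"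
      using f by (simp add: sum.distrib hnorm_cscale norm_mult power_mult_distrib)
    finally have "(hnorm ip (coord_shift i q + cscale ?\<epsilon> (coord_shift j f)))\<^sup>2
        \<le> (hnorm ip q)\<^sup>2 + t\<^sup>2 * ((cmod c)\<^sup>2 * (hnorm ip f)\<^sup>2)"
      using row_contraction(2)[of ?F, OF F] unfolding row by simp
    moreover have "(hnorm ip (coord_shift i q + cscale ?\<epsilon> (coord_shift j f)))\<^sup>2
        = (hnorm ip (coord_shift i q))\<^sup>2 + 2 * (t * (cmod c)\<^sup>2) + (hnorm ip (cscale ?\<epsilon> (coord_shift j f)))\<^sup>2"
    proof -
      have "ip (coord_shift i q) (cscale ?\<epsilon> (coord_shift j f)) = of_real t * (c * cnj c)"
        using mem by (simp add: ip_scale_right c_def mult_ac)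
      also have "\<dots> = of_real (t * (cmod c)\<^sup>2)"
        by (simp only: complex_norm_square of_real_mult)
      finally show ?thesis
        using mem by (subst hnorm_add_sq) (auto simp del: of_real_mult)
    qed
    moreover have "(hnorm ip q)\<^sup>2 \<le> (hnorm ip (coord_shift i q))\<^sup>2"
      using q by (intro power_mono) auto
    moreover have "0 \<le> (hnorm ip (cscale ?\<epsilon> (coord_shift j f)))\<^sup>2" by simp
    ultimately show ?thesis by linarith
  qed
  then have "- (cmod c)\<^sup>2 = 0" by (rule linear_coefficient_zero)
  then show ?thesis by (simp add: c_def)
qed

text \<open>Subtracting the two recursions cancels the constant 1, and
  \<open>bip z w - bip z w'\<close> involves the j-th coordinate only.\<close>

lemma K_diff_recursion:
  assumes "w \<in> D" "w' \<in> D" and eq: "\<And>k. k \<noteq> j \<Longrightarrow> w' $ k = w $ k"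
  shows "K w - K w' = mult_op (\<lambda>z. bip z w) (K w - K w')
    + coord_shift j (cscale (cnj (w $ j - w' $ j)) (K w'))"
proof
  fix z
  show "(K w - K w') z = (mult_op (\<lambda>z. bip z w) (K w - K w')
    + coord_shift j (cscale (cnj (w $ j - w' $ j)) (K w'))) z"
  proof (cases "z \<in> D")
    case True
    have "bip z w - bip z w' = (\<Sum>k\<in>UNIV. if k = j then z $ j * cnj (w $ j - w' $ j) else 0)"
      unfolding bip_def sum_subtractf[symmetric]
      using eq by (intro sum.cong) (auto simp: algebra_simps)
    then have d: "bip z w - bip z w' = z $ j * cnj (w $ j - w' $ j)" by simp
    have b: "bip z w' = bip z w - z $ j * cnj (w $ j - w' $ j)" unfolding d[symmetric] by simp
    have 1: "K w z - bip z w * K w z = 1"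
      using K_recursion[OF True assms(1)] by (metis add_diff_cancel_right')
    have 2: "K w' z - bip z w' * K w' z = 1"
      using K_recursion[OF True assms(2)] by (metis add_diff_cancel_right')
    have "(K w z - K w' z) - (bip z w * (K w z - K w' z) + z $ j * cnj (w $ j - w' $ j) * K w' z)
        = (K w z - bip z w * K w z) - (K w' z - bip z w' * K w' z)"
      unfolding b by (simp add: algebra_simps)
    then have "K w z - K w' z = bip z w * (K w z - K w' z) + z $ j * cnj (w $ j - w' $ j) * K w' z"
      unfolding 1 2 by simp
    then show ?thesis by (simp add: mult_op_def coord_shift_def mult.assoc)
  next
    case False
    then show ?thesis by (simp add: mult_op_def coord_shift_def K_outside)
  qed
qed

text \<open>Iterating \<open>K_diff_recursion\<close> writes K_w - K_w' as its product with (bip z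
  w)^N plus an element of z_j H. The first part has norm at most |w|^N |K_w - K_w'|, so
  \<open>g\<close> is orthogonal to the difference.\<close>

lemma orthogonal_range_coord_indep:
  assumes g: "g \<in> H" and orth: "\<And>f. f \<in> H \<Longrightarrow> ip g (coord_shift j f) = 0"
    and w: "w \<in> D" "w' \<in> D" "\<And>k. k \<noteq> j \<Longrightarrow> w' $ k = w $ k"
  shows "g w = g w'"
proof -
  define u where "u = K w - K w'"
  define v where "v N = mult_op (\<lambda>z. bip z w ^ N) u" for N
  have u: "u \<in> H" using w by (simp add: u_def)
  have v_Suc: "v (Suc N) = mult_op (\<lambda>z. bip z w) (v N)" for N
    by (auto simp: v_def mult_op_def)
  have v_0: "v 0 = u" by (simp add: v_def mult_op_def)
  have v: "v N \<in> H \<and> hnorm ip (v N) \<le> norm w ^ N * hnorm ip u" for N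
  proof (induction N)
    case 0
    then show ?case using u by (simp add: v_0)
  next
    case (Suc N)
    have "hnorm ip (v (Suc N)) \<le> norm w * hnorm ip (v N)"
      unfolding v_Suc using Suc.IH by (intro mult_bip_norm_le) blast
    also have "\<dots> \<le> norm w * (norm w ^ N * hnorm ip u)"
      using Suc.IH by (intro mult_left_mono) auto
    finally show ?case
      using Suc.IH mult_bip_mem[of "v N" w] by (simp add: v_Suc mult.assoc)
  qed
  have step: "ip g (v N) = ip g (v (Suc N))" for N
  proof -
    let ?f = "mult_op (\<lambda>z. bip z w ^ N) (cscale (cnj (w $ j - w' $ j)) (K w'))"
    have f: "?f \<in> H"
      unfolding bip_def using w
      by (intro multiplier_mem multiplier_power multiplier_sum multiplier_mult multiplier_coord
          multiplier_const) auto
    have "v N = mult_op (\<lambda>z. bip z w ^ N) (mult_op (\<lambda>z. bip z w) u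
        + coord_shift j (cscale (cnj (w $ j - w' $ j)) (K w')))"
      unfolding v_def u_def using K_diff_recursion[OF w] by (rule arg_cong)
    also have "\<dots> = v (Suc N) + coord_shift j ?f"
      by (auto simp: v_def mult_op_def coord_shift_def fun_eq_iff algebra_simps)
    finally have "ip g (v N) = ip g (v (Suc N)) + ip g (coord_shift j ?f)"
      using g v f coord_shift_mem by (simp only: ip_add_right)
    then show ?thesis using orth[OF f] by simp
  qed
  have "ip g u = ip g (v N)" for N
    by (induction N) (simp add: v_0, use step in simp)
  then have le: "cmod (ip g u) \<le> hnorm ip g * (norm w ^ N * hnorm ip u)" for N
  proof -
    have "cmod (ip g u) = cmod (ip g (v N))" using \<open>\<And>N. ip g u = ip g (v N)\<close> by simp
    also have "\<dots> \<le> hnorm ip g * hnorm ip (v N)" using g v by (intro cauchy_schwarz) blast+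
    also have "\<dots> \<le> hnorm ip g * (norm w ^ N * hnorm ip u)"
      using g v by (intro mult_left_mono) auto
    finally show ?thesis .
  qed
  have "(\<lambda>N. hnorm ip g * (norm w ^ N * hnorm ip u)) \<longlonglongrightarrow> hnorm ip g * (0 * hnorm ip u)"
    using w(1) by (intro tendsto_intros LIMSEQ_power_zero) simp
  then have "cmod (ip g u) \<le> hnorm ip g * (0 * hnorm ip u)"
    by (rule LIMSEQ_le_const) (use le in blast)
  then have "ip g u = 0" by simp
  then show ?thesis using g w by (simp add: u_def ip_diff_right ip_K)
qed

end

section \<open>Polynomials as functions\<close>

text \<open>Dedekind's independence of characters, here for a set merely closed under
  multiplication.\<close>

lemma character_independence:
  fixes h :: "'i \<Rightarrow> 'a::times \<Rightarrow> complex"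
  assumes "finite M"
    and mult: "\<And>m x y. \<lbrakk>m \<in> M; x \<in> G; y \<in> G\<rbrakk> \<Longrightarrow> h m (x * y) = h m x * h m y"
    and closed: "\<And>x y. \<lbrakk>x \<in> G; y \<in> G\<rbrakk> \<Longrightarrow> x * y \<in> G"
    and nonzero: "\<And>m. m \<in> M \<Longrightarrow> \<exists>x\<in>G. h m x \<noteq> 0"
    and distinct: "\<And>m m'. \<lbrakk>m \<in> M; m' \<in> M; m \<noteq> m'\<rbrakk> \<Longrightarrow> \<exists>x\<in>G. h m x \<noteq> h m' x"
    and "\<And>x. x \<in> G \<Longrightarrow> (\<Sum>m\<in>M. c m * h m x) = 0"
    and "m \<in> M"
  shows "c m = 0"
  using assms(1) mult nonzero distinct assms(6,7)
proof (induction M arbitrary: c m rule: finite_induct)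
  case empty
  then show ?case by simp
next
  case (insert a M)
  have c0: "c m' = 0" if m': "m' \<in> M" for m'
  proof -
    obtain y where y: "y \<in> G" "h m' y \<noteq> h a y"
      using insert.prems(3)[of m' a] m' insert.hyps(2) by auto
    \<comment> \<open>Evaluating the relation at y x and subtracting \<open>h a y\<close> times the
      relation at x eliminates the character \<open>a\<close>.\<close>
    have "c m' * (h m' y - h a y) = 0"
    proof (rule insert.IH[where c = "\<lambda>m. c m * (h m y - h a y)"])
      fix x assume x: "x \<in> G"
      have "(\<Sum>m\<in>insert a M. c m * h m (y * x)) = 0" using x y closed insert.prems(4) by blast
      then have 1: "(\<Sum>m\<in>insert a M. c m * (h m y * h m x)) = 0"
        using insert.prems(1) x y by simp
      have 2: "h a y * (\<Sum>m\<in>insert a M. c m * h m x) = 0"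
        using insert.prems(4)[OF x] by simp
      have "(\<Sum>m\<in>insert a M. c m * (h m y - h a y) * h m x)
          = (\<Sum>m\<in>insert a M. c m * (h m y * h m x)) - h a y * (\<Sum>m\<in>insert a M. c m * h m x)"
        unfolding sum_distrib_left sum_subtractf[symmetric]
        by (intro sum.cong) (auto simp: algebra_simps)
      then have "(\<Sum>m\<in>insert a M. c m * (h m y - h a y) * h m x) = 0"
        by (simp only: 1 2 diff_self)
      then show "(\<Sum>m\<in>M. c m * (h m y - h a y) * h m x) = 0"
        using insert.hyps by simp
    qed (use insert.prems m' in auto)
    then show ?thesis using y by simp
  qed
  obtain x where x: "x \<in> G" "h a x \<noteq> 0" using insert.prems(2) by blast
  have "(\<Sum>m\<in>insert a M. c m * h m x) = c a * h a x"
    using insert.hyps c0 by simp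
  then have "c a = 0" using insert.prems(4)[OF x(1)] x(2) by simp
  then show ?case using c0 insert.prems(5) by auto
qed

text \<open>A product of punctured discs, so coordinates can be changed one at a time. The radius
  keeps it in the ball and closed under coordinatewise products; the puncture keeps monomials
  nonzero and allows division by a coordinate.\<close>

definition small_box :: "(complex ^ 'd::finite) set"
  where "small_box = {z. \<forall>k. z $ k \<noteq> 0 \<and> cmod (z $ k) < 1 / real CARD('d)}"

lemma small_box_subset: "small_box \<subseteq> (ball 0 1 :: (complex ^ 'd::finite) set)"
proof
  fix z :: "complex ^ 'd" assume z: "z \<in> small_box"
  have "norm z \<le> (\<Sum>k\<in>UNIV. cmod (z $ k))"
    unfolding norm_vec_def by (rule L2_set_le_sum) simp
  also have "\<dots> < (\<Sum>k\<in>(UNIV :: 'd set). 1 / real CARD('d))"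
    using z by (intro sum_strict_mono) (auto simp: small_box_def)
  finally show "z \<in> ball 0 1" by simp
qed

text \<open>Monomials are characters for coordinatewise multiplication. Their independence is
  applied to the polynomial with \<open>c\<close> subtracted from its constant term.\<close>

lemma poly_fun_const_on_small_box:
  fixes p :: "'d::finite cpoly"
  assumes const: "\<And>z. z \<in> small_box \<Longrightarrow> poly_fun p z = c"
  shows "constant_poly p"
proof -
  let ?A = "Poly_Mapping.lookup ` Poly_Mapping.keys p"
  \<comment> \<open>The zero exponent is added so that \<open>c\<close> can be subtracted even if
    the polynomial has no constant term.\<close>
  define M where "M = insert (\<lambda>_. 0) ?A"
  have finM: "finite M" by (simp add: M_def)
  define u where "u \<alpha> = pcoeff p \<alpha> - (if \<alpha> = (\<lambda>_. 0) then c else 0)" for \<alpha>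
  have mon_const: "mon (\<lambda>_. 0) z = 1" for z :: "complex ^ 'd" by (simp add: mon_def)
  define r where "r = 1 / (2 * real CARD('d))"
  have r: "r > 0" "r < 1 / real CARD('d)" by (auto simp: r_def field_simps)
  have d1: "1 / real CARD('d) \<le> 1" by (simp add: divide_le_eq_1 Suc_leI)
  have u0: "u \<alpha> = 0" if "\<alpha> \<in> M" for \<alpha>
  proof (rule character_independence[where h = mon and G = small_box, OF finM _ _ _ _ _ that])
    show "mon \<beta> (x * y) = mon \<beta> x * mon \<beta> y" for \<beta> and x y :: "complex ^ 'd"
      by (simp add: mon_def power_mult_distrib prod.distrib)
    show "x * y \<in> small_box" if xy: "x \<in> small_box" "y \<in> small_box" for x y :: "complex ^ 'd"
      unfolding small_box_def
    proof (intro CollectI allI conjI)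
      fix k
      show "(x * y) $ k \<noteq> 0" using xy by (simp add: small_box_def)
      have "cmod (x $ k) * cmod (y $ k) \<le> cmod (x $ k) * 1"
      proof (rule mult_left_mono)
        have "cmod (y $ k) < 1 / real CARD('d)" using xy by (simp add: small_box_def)
        then show "cmod (y $ k) \<le> 1" using d1 by linarith
      qed simp
      also have "\<dots> < 1 / real CARD('d)" using xy by (simp add: small_box_def)
      finally show "cmod ((x * y) $ k) < 1 / real CARD('d)" by (simp add: norm_mult)
    qed
    have vec_r: "(\<chi> k. complex_of_real (s k)) \<in> small_box" if "\<And>k. 0 < s k \<and> s k \<le> r" for s :: "'d \<Rightarrow> real"
      unfolding small_box_def
    proof (intro CollectI allI conjI)
      fix k
      have "0 < s k" "s k \<le> r" using that by auto
      then show "(\<chi> k. complex_of_real (s k)) $ k \<noteq> 0"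
        "cmod ((\<chi> k. complex_of_real (s k)) $ k) < 1 / real CARD('d)" using r(2) by auto
    qed
    show "\<exists>x\<in>small_box. mon \<beta> x \<noteq> 0" for \<beta> :: "'d \<Rightarrow> nat"
      using vec_r[of "\<lambda>_. r"] r by (intro bexI) (auto simp: mon_def)
    show "\<exists>x\<in>small_box. mon \<beta> x \<noteq> mon \<gamma> x" if neq: "\<beta> \<noteq> \<gamma>" for \<beta> \<gamma> :: "'d \<Rightarrow> nat"
    proof (rule ccontr)
      assume "\<not> ?thesis"
      then have same: "\<And>x. x \<in> small_box \<Longrightarrow> mon \<beta> x = mon \<gamma> x" by blast
      obtain i where i: "\<beta> i \<noteq> \<gamma> i" using neq by blast
      let ?x = "(\<chi> k. complex_of_real r) :: complex ^ 'd"
      \<comment> \<open>Halving the i-th coordinate multiplies a monomial by 1/2 to its i-th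
        exponent, which tells apart exponents that differ at i.\<close>
      let ?y = "(\<chi> k. complex_of_real (if k = i then r / 2 else r)) :: complex ^ 'd"
      have x: "?x \<in> small_box" using r by (intro vec_r) auto
      have y: "?y \<in> small_box" using r by (intro vec_r) auto
      have mon_y: "mon \<delta> ?y = (1/2) ^ \<delta> i * mon \<delta> ?x" for \<delta> :: "'d \<Rightarrow> nat"
      proof -
        have "mon \<delta> ?y = (\<Prod>k\<in>UNIV. (if k = i then (1/2) ^ \<delta> i else 1) * (?x $ k) ^ \<delta> k)"
          unfolding mon_def by (intro prod.cong) (auto simp: power_divide)
        then show ?thesis by (simp add: prod.distrib mon_def)
      qed
      have "mon \<gamma> ?x \<noteq> 0" using r by (simp add: mon_def)
      moreover have "(1/2) ^ \<beta> i * mon \<beta> ?x = (1/2) ^ \<gamma> i * mon \<gamma> ?x"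
        using same[OF y] mon_y[of \<beta>] mon_y[of \<gamma>] by simp
      ultimately have "(1/2 :: complex) ^ \<beta> i = (1/2) ^ \<gamma> i"
        using same[OF x] by simp
      then have "cmod ((1/2) ^ \<beta> i) = cmod ((1/2) ^ \<gamma> i)" by simp
      then have "(1/2 :: real) ^ \<beta> i = (1/2) ^ \<gamma> i" by (simp add: norm_power)
      then show False using i power_inject_exp'[of "1/2 :: real"] by auto
    qed
    show "(\<Sum>\<beta>\<in>M. u \<beta> * mon \<beta> x) = 0" if x: "x \<in> small_box" for x :: "complex ^ 'd"
    proof -
      have "(\<Sum>\<beta>\<in>M. u \<beta> * mon \<beta> x)
          = (\<Sum>\<beta>\<in>M. pcoeff p \<beta> * mon \<beta> x) - (\<Sum>\<beta>\<in>M. if \<beta> = (\<lambda>_. 0) then c * mon \<beta> x else 0)"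
        unfolding sum_subtractf[symmetric] by (intro sum.cong) (auto simp: u_def algebra_simps)
      also have "(\<Sum>\<beta>\<in>M. if \<beta> = (\<lambda>_. 0) then c * mon \<beta> x else 0) = c"
        using finM by (simp add: M_def mon_const)
      also have "(\<Sum>\<beta>\<in>M. pcoeff p \<beta> * mon \<beta> x) = poly_fun p x"
        unfolding poly_fun_eq M_def by (rule sum.mono_neutral_right) (auto simp: pcoeff_eq_0)
      finally show ?thesis using const[OF x] by simp
    qed
  qed
  have "p = Poly_Mapping.single 0 c"
  proof (rule poly_mapping_eqI)
    fix m :: "'d \<Rightarrow>\<^sub>0 nat"
    have lookup: "Poly_Mapping.lookup p m = pcoeff p (Poly_Mapping.lookup m)" by (simp add: pcoeff_def)
    have m0: "Poly_Mapping.lookup m = (\<lambda>_. 0) \<longleftrightarrow> m = 0"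
      by (metis lookup_inject lookup_zero ext)
    show "Poly_Mapping.lookup p m = Poly_Mapping.lookup (Poly_Mapping.single 0 c) m"
    proof (cases "Poly_Mapping.lookup m \<in> M")
      case True
      then show ?thesis using u0[OF True] m0 unfolding lookup u_def by (auto simp: lookup_single)
    next
      case False
      then have "pcoeff p (Poly_Mapping.lookup m) = 0" "m \<noteq> 0"
        using m0 by (auto simp: M_def pcoeff_eq_0)
      then show ?thesis unfolding lookup by (simp add: lookup_single)
    qed
  qed
  then show ?thesis unfolding constant_poly_def by blast
qed

lemma poly_fun_line:
  fixes p :: "'d::finite cpoly"
  shows "\<exists>Q :: complex poly. \<forall>t :: real. poly_fun p (w + t *\<^sub>R v) = poly Q (of_real t)"
proof -
  define R where "R f \<longleftrightarrow> (\<exists>Q :: complex poly. \<forall>t :: real. f (w + t *\<^sub>R v) = poly Q (of_real t))"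
    for f :: "complex ^ 'd \<Rightarrow> complex"
  have const: "R (\<lambda>_. c)" for c unfolding R_def by (intro exI[of _ "[:c:]"]) simp
  have coord: "R (\<lambda>z. z $ i)" for i
    unfolding R_def by (intro exI[of _ "[:w $ i, v $ i:]"]) (simp add: scaleR_conv_of_real[where 'a = complex])
  have add: "R (\<lambda>z. f z + g z)" if "R f" "R g" for f g
    using that unfolding R_def by (metis poly_add)
  have mult: "R (\<lambda>z. f z * g z)" if "R f" "R g" for f g
    using that unfolding R_def by (metis poly_mult)
  have power: "R (\<lambda>z. f z ^ n)" if "R f" for f n
    by (induction n) (use const[of 1] mult that in \<open>simp_all\<close>)
  have sum: "R (\<lambda>z. \<Sum>i\<in>A. f i z)" if "\<And>i. i \<in> A \<Longrightarrow> R (f i)" for A :: "('d \<Rightarrow>\<^sub>0 nat) set" and f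
    using that by (induction A rule: infinite_finite_induct) (use const[of 0] add in simp_all)
  have prod: "R (\<lambda>z. \<Prod>i\<in>A. f i z)" if "\<And>i. i \<in> A \<Longrightarrow> R (f i)" for A :: "'d set" and f
    using that by (induction A rule: infinite_finite_induct) (use const[of 1] mult in simp_all)
  have "R (poly_fun p)"
    unfolding poly_fun_def[abs_def] by (intro sum mult prod power const coord)
  then show ?thesis by (simp add: R_def)
qed

text \<open>On the real segment from \<open>w\<close> to \<open>v0\<close> the polynomial becomes a
  nonzero polynomial in one variable; its finitely many roots can be avoided arbitrarily close to
  \<open>w\<close>.\<close>

lemma poly_fun_nonzero_dense:
  fixes p :: "'d::finite cpoly"
  assumes v0: "v0 \<in> ball 0 1" "poly_fun p v0 \<noteq> 0" and w: "w \<in> ball 0 1"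
  shows "w \<in> closure {v \<in> ball 0 1. poly_fun p v \<noteq> 0}"
proof -
  obtain Q :: "complex poly" where Q: "\<And>t :: real. poly_fun p (w + t *\<^sub>R (v0 - w)) = poly Q (of_real t)"
    using poly_fun_line[of p w "v0 - w"] by blast
  have "Q \<noteq> 0" using Q[of 1] v0(2) by auto
  then have "finite {x. poly Q x = 0}" by (rule poly_roots_finite)
  then have fin: "finite (complex_of_real -` {x. poly Q x = 0})"
    by (rule finite_vimageI) (simp add: inj_def)
  have "\<exists>t. 0 < t \<and> t < 1 / real (Suc n) \<and> poly Q (complex_of_real t) \<noteq> 0" for n
  proof -
    have "infinite ({0<..<1 / real (Suc n)} - complex_of_real -` {x. poly Q x = 0})"
      by (rule Diff_infinite_finite[OF fin]) (simp add: infinite_Ioo)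
    then have "{0<..<1 / real (Suc n)} - complex_of_real -` {x. poly Q x = 0} \<noteq> {}"
      by (metis finite.emptyI)
    then show ?thesis by auto
  qed
  then obtain t where t: "\<And>n. 0 < t n" "\<And>n. t n < 1 / real (Suc n)" "\<And>n. poly Q (complex_of_real (t n)) \<noteq> 0"
    by metis
  let ?x = "\<lambda>n. w + t n *\<^sub>R (v0 - w)"
  have "?x n \<in> {v \<in> ball 0 1. poly_fun p v \<noteq> 0}" for n
  proof -
    have "1 / real (Suc n) \<le> 1" by simp
    with t(2)[of n] have "t n \<le> 1" by linarith
    then have "(1 - t n) *\<^sub>R w + t n *\<^sub>R v0 \<in> ball 0 1"
      using t(1)[of n] v0(1) w convex_ball[of "0 :: complex ^ 'd" 1] by (intro convexD) auto
    then have "?x n \<in> ball 0 1" by (simp add: algebra_simps)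
    then show ?thesis using Q t(3)[of n] by simp
  qed
  moreover have "?x \<longlonglongrightarrow> w"
  proof -
    have "t \<longlonglongrightarrow> 0"
    proof (rule tendsto_sandwich)
      show "\<forall>\<^sub>F n in sequentially. 0 \<le> t n" using t(1) by (simp add: less_imp_le)
      show "\<forall>\<^sub>F n in sequentially. t n \<le> 1 / real (Suc n)" using t(2) by (simp add: less_imp_le)
      show "(\<lambda>n. 1 / real (Suc n)) \<longlonglongrightarrow> 0"
        using LIMSEQ_inverse_real_of_nat by (simp add: inverse_eq_divide)
    qed simp
    then have "?x \<longlonglongrightarrow> w + 0 *\<^sub>R (v0 - w)" by (intro tendsto_intros)
    then show ?thesis by simp
  qed
  ultimately show ?thesis unfolding closure_sequential by (intro exI[of _ ?x]) simp
qed

context drury_arveson_space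
begin

lemma eq_on_dense:
  assumes "g \<in> H" "h \<in> H" and T: "T \<subseteq> D" "D \<subseteq> closure T" and eq: "\<And>v. v \<in> T \<Longrightarrow> g v = h v"
  shows "g = h"
proof (rule eqI_D[OF assms(1,2)])
  fix w assume w: "w \<in> D"
  then have "w \<in> closure T" using T(2) by blast
  then obtain x where x: "\<And>n. x n \<in> T" "x \<longlonglongrightarrow> w"
    unfolding closure_sequential by blast
  have xD: "\<forall>\<^sub>F n in sequentially. x n \<in> D" using x(1) T(1) by (intro always_eventually) blast
  have "(\<lambda>n. g (x n)) \<longlonglongrightarrow> g w"
    using continuous_on_D[OF assms(1)] x(2) w xD by (rule continuous_on_tendsto_compose)
  moreover have "(\<lambda>n. h (x n)) \<longlonglongrightarrow> h w"
    using continuous_on_D[OF assms(2)] x(2) w xD by (rule continuous_on_tendsto_compose)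
  moreover have "(\<lambda>n. g (x n)) = (\<lambda>n. h (x n))" using eq x(1) by blast
  ultimately show "g w = h w" using LIMSEQ_unique by metis
qed

end

section \<open>Isometry and constancy for a single generator\<close>

context poly_submodule
begin

text \<open>It suffices that the adjoint of M_\<phi> returns \<open>g\<close> from \<phi> g.
  Evaluating \<phi> g, an element of \<open>S\<close>, through \<open>kS v\<close> gives this up to
  the factor \<phi>(v), which cancels on a dense set.\<close>

lemma rank_1_isometry:
  assumes \<phi>: "multiplier \<phi>"
    and ker: "\<And>w. w \<in> D \<Longrightarrow> kS w = cscale (cnj (\<phi> w)) (mult_op \<phi> (K w))"
    and dense: "D \<subseteq> closure {v \<in> D. \<phi> v \<noteq> 0}"
    and g: "g \<in> H" "mult_op \<phi> g \<in> S" and f: "f \<in> H"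
  shows "ip (mult_op \<phi> f) (mult_op \<phi> g) = ip f g"
proof -
  have bd: "bounded_operator H ip (mult_op \<phi>)" using \<phi> by (rule multiplier_bounded)
  define h where "h = hadjoint H ip (mult_op \<phi>) (mult_op \<phi> g)"
  have \<phi>g: "mult_op \<phi> g \<in> H" using g(2) by (rule S_in_H)
  have h: "h \<in> H" unfolding h_def by (rule hadjoint_mem[OF bd \<phi>g])
  have adj: "ip (mult_op \<phi> f) (mult_op \<phi> g) = ip f h" if "f \<in> H" for f
    unfolding h_def by (rule hadjoint_ip[OF bd \<phi>g that])
  have "h = g"
  proof (rule eq_on_dense[OF h g(1) _ dense])
    fix v assume "v \<in> {v \<in> D. \<phi> v \<noteq> 0}"
    then have v: "v \<in> D" "\<phi> v \<noteq> 0" by auto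
    have \<phi>K: "mult_op \<phi> (K v) \<in> H" using \<phi> K_mem[OF v(1)] by (rule multiplier_mem)
    have "\<phi> v * g v = ip (mult_op \<phi> g) (kS v)"
      using ip_kS[OF v(1) g(2)] by (simp add: mult_op_def)
    also have "\<dots> = \<phi> v * ip (mult_op \<phi> g) (mult_op \<phi> (K v))"
      unfolding ker[OF v(1)] using \<phi>g \<phi>K by (simp add: ip_scale_right)
    also have "\<dots> = \<phi> v * cnj (ip (K v) h)"
      using ip_commute[OF \<phi>K \<phi>g] adj[OF K_mem[OF v(1)]] by simp
    also have "\<dots> = \<phi> v * h v"
      using ip_commute[OF K_mem[OF v(1)] h] ip_K[OF h v(1)] by simp
    finally show "h v = g v" using v(2) by simp
  qed auto
  then show ?thesis using adj[OF f] by simp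
qed

lemma rank_1_constant:
  assumes d: "CARD('d) \<ge> 2"
    and \<phi>: "multiplier \<phi>" "mult_op \<phi> (K 0) \<in> S"
    and ker: "\<And>w. w \<in> D \<Longrightarrow> kS w = cscale (cnj (\<phi> w)) (mult_op \<phi> (K w))"
    and dense: "D \<subseteq> closure {v \<in> D. \<phi> v \<noteq> 0}"
  shows "\<exists>c. \<forall>z\<in>small_box. \<phi> z = c"
proof -
  define q where "q = mult_op \<phi> (K 0)"
  have q: "q \<in> S" "q \<in> H" using \<phi>(2) S_in_H by (auto simp: q_def)
  have q_apply: "q z = \<phi> z" if "z \<in> D" for z using that by (simp add: q_def mult_op_def K_0)
  have K0: "K 0 \<in> H" by (intro K_mem) simp
  have Z: "coord_shift i (K 0) \<in> H" for i using K0 by (rule coord_shift_mem)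
  have "ip q q = ip (K 0) (K 0)"
    unfolding q_def by (rule rank_1_isometry[OF \<phi>(1) ker dense K0 \<phi>(2) K0])
  also have "\<dots> = 1" using ip_K[OF K0, of 0] by (simp add: K_0)
  finally have "complex_of_real ((hnorm ip q)\<^sup>2) = 1" by (simp only: ip_self[OF q(2)])
  then have norm_q: "(hnorm ip q)\<^sup>2 = 1" by (simp only: of_real_eq_1_iff)
  \<comment> \<open>By isometry |z_i q| = |z_i|, and |z_i| is at least 1 = |q|.\<close>
  have norm_le: "hnorm ip q \<le> hnorm ip (coord_shift i q)" for i
  proof (rule power2_le_imp_le)
    have eq: "coord_shift i q = mult_op \<phi> (coord_shift i (K 0))"
      by (auto simp: q_def mult_op_def coord_shift_def fun_eq_iff)
    have mem: "mult_op \<phi> (coord_shift i (K 0)) \<in> S"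
      unfolding eq[symmetric] using q(1) by (rule shift_mem)
    have "ip (coord_shift i q) (coord_shift i q) = ip (coord_shift i (K 0)) (coord_shift i (K 0))"
      unfolding eq by (rule rank_1_isometry[OF \<phi>(1) ker dense Z mem Z])
    then have "complex_of_real ((hnorm ip (coord_shift i q))\<^sup>2) = of_real ((hnorm ip (coord_shift i (K 0)))\<^sup>2)"
      by (simp only: ip_self[OF Z] ip_self[OF coord_shift_mem[OF q(2)]])
    then show "(hnorm ip q)\<^sup>2 \<le> (hnorm ip (coord_shift i q))\<^sup>2"
      using coord_shift_K0_norm_ge[of i] by (simp only: of_real_eq_iff norm_q)
    show "0 \<le> hnorm ip (coord_shift i q)" using coord_shift_mem[OF q(2)] by simp
  qed
  have indep: "q w = q w'"
    if w: "w \<in> small_box" "w' \<in> small_box" and eq: "\<And>k. k \<noteq> j \<Longrightarrow> w' $ k = w $ k" for w w' j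
  proof -
    \<comment> \<open>Orthogonality is available only for shifts in two different directions, so a
      second coordinate must exist.\<close>
    have "\<exists>i. i \<noteq> j"
    proof (rule ccontr)
      assume "\<not> ?thesis"
      then have "(UNIV :: 'd set) = {j}" by auto
      then have "CARD('d) = card {j}" by (simp only:)
      then show False using d by simp
    qed
    then obtain i where i: "i \<noteq> j" by blast
    have D: "w \<in> D" "w' \<in> D" using w small_box_subset by blast+
    \<comment> \<open>The independence of z_j is obtained for z_i q; the factor z_i is then divided
      out, as it is nonzero on the box and unaffected by the j-th coordinate.\<close>
    have "coord_shift i q w = coord_shift i q w'"
    proof (rule orthogonal_range_coord_indep[OF coord_shift_mem[OF q(2)] _ D eq])
      show "ip (coord_shift i q) (coord_shift j f) = 0" if "f \<in> H" for f
        using q(2) norm_le i that by (rule norm_attained_orthogonal)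
    qed
    moreover have "w $ i \<noteq> 0" using w(1) by (simp add: small_box_def)
    ultimately show ?thesis using eq[OF i] by (simp add: coord_shift_def mult_op_def)
  qed
  have const: "q z = q z'" if z: "z \<in> small_box" "z' \<in> small_box" for z z'
  proof -
    \<comment> \<open>Intermediate points that exchange the coordinates of \<open>z\<close> for
      those of \<open>z'\<close> one at a time without leaving the box.\<close>
    define y where "y A = (\<chi> k. if k \<in> A then z' $ k else z $ k)" for A :: "'d set"
    have y: "y A \<in> small_box" for A using z by (auto simp: y_def small_box_def)
    have "q z = q (y A)" if "finite A" for A
      using that
    proof (induction A rule: finite_induct)
      case empty
      then show ?case by (simp add: y_def)
    next
      case (insert j A)
      have "q (y A) = q (y (insert j A))"
        by (rule indep[OF y y, of j]) (auto simp: y_def)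
      then show ?case using insert.IH by simp
    qed
    from this[of UNIV] have "q z = q (y UNIV)" by simp
    moreover have "y UNIV = z'" by (simp add: y_def)
    ultimately show ?thesis by simp
  qed
  show ?thesis
  proof (cases "small_box = ({} :: (complex ^ 'd) set)")
    case False
    then obtain z0 :: "complex ^ 'd" where z0: "z0 \<in> small_box" by blast
    have "\<phi> z = q z0" if "z \<in> small_box" for z
      using const[OF that z0] q_apply[of z] that small_box_subset by auto
    then show ?thesis by blast
  qed simp
qed

end

section \<open>Reduction to one generator\<close>

theorem corollary4p4:
  fixes H S :: "(complex ^ 'd::finite \<Rightarrow> complex) set"
    and ip :: "(complex ^ 'd \<Rightarrow> complex) \<Rightarrow> (complex ^ 'd \<Rightarrow> complex) \<Rightarrow> complex"
    and n :: nat
    and p :: "nat \<Rightarrow> 'd cpoly"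
  assumes "CARD('d) \<ge> 2"
    and "drury_arveson H ip"
    and "submodule H ip S"
    and "Delta S ip (coord_shift :: 'd \<Rightarrow> _) 1 < \<infinity>"
    and "n \<ge> 1"
    and "\<And>i. i \<in> {1..n} \<Longrightarrow> \<not> constant_poly (p i)"
    and "\<And>f. f \<in> H \<Longrightarrow> hprojection ip S f =
      (\<Sum>i=1..n. mult_op (poly_fun (p i)) (hadjoint H ip (mult_op (poly_fun (p i))) f))"
  shows "\<not> maximal_submodule ip S"
proof
  assume "maximal_submodule ip S"
  then have max: "maximal_tuple S ip (coord_shift :: 'd \<Rightarrow> _)"
    by (simp add: maximal_submodule_def)
  have "poly_submodule H ip S {1..n} p"
  proof (intro poly_submodule.intro poly_submodule_axioms.intro drury_arveson_space.intro)
    show "drury_arveson H ip" by fact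
    show "submodule H ip S" by fact
    show "hilbert_function_space S ip"
      using max by (simp add: maximal_tuple_def)
    show "bounded_operator S ip (coord_shift i)" for i :: 'd
      using max by (simp add: maximal_tuple_def contractive_tuple_def)
    show "finite {1..n}" by simp
  qed (rule assms(7))
  then interpret poly_submodule H ip S "{1..n}" p .
  have Delta_max: "Delta S ip (coord_shift :: 'd \<Rightarrow> _) m =
      enat (\<Sum>k<m. (k + CARD('d) - 1) choose (CARD('d) - 1)) * Delta S ip (coord_shift :: 'd \<Rightarrow> _) 1"
    if "m \<ge> 1" for m
    using max that unfolding maximal_tuple_def by blast
  have P_nonzero: "P i \<noteq> 0" if i: "i \<in> {1..n}" for i
  proof
    assume P0: "P i = 0"
    have "poly_fun (p i) z = 0" if "z \<in> small_box" for z
      using P_apply[of z i] that small_box_subset P0 by auto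
    then have "constant_poly (p i)" by (rule poly_fun_const_on_small_box)
    then show False using assms(6)[OF i] by blast
  qed
  obtain B where B: "B \<subseteq> P ` {1..n}" "fun_space.independent B" "P ` {1..n} \<subseteq> fun_space.span B"
    using fun_space.maximal_independent_subset[of "P ` {1..n}"] by blast
  have span: "fun_space.span B = fun_space.span (P ` {1..n})"
    using B(1,3) by (simp add: fun_space.span_eq fun_space.span_superset subset_trans)
  have one: "1 \<in> {1..n}" using assms(5) by simp
  have "B \<noteq> {}"
  proof
    assume "B = {}"
    then have "P 1 \<in> {0}" using B(3) one by (metis fun_space.span_empty image_eqI subsetD)
    then show False using P_nonzero[OF one] by blast
  qed
  then obtain i0 where i0: "i0 \<in> {1..n}" "P i0 \<in> B" using B(1) by blast
  have "B = {P i0}"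
    using maximal_rank_le_1[OF Delta_max B(2,1) span _ i0(2)] i0(2) by blast
  then have "P ` {1..n} \<subseteq> range (\<lambda>c. cscale c (P i0))"
    using B(3) by (simp only: fun_space.span_singleton)
  then have "\<exists>c. P i = cscale c (P i0)" if "i \<in> {1..n}" for i
    using that by blast
  then obtain a where a: "\<And>i. i \<in> {1..n} \<Longrightarrow> P i = cscale (a i) (P i0)" by metis
  define s where "s = (\<Sum>i\<in>{1..n}. (cmod (a i))\<^sup>2)"
  have "a i0 \<noteq> 0"
  proof
    assume "a i0 = 0"
    then have "P i0 = 0" using a[OF i0(1)] by simp
    then show False using P_nonzero[OF i0(1)] by blast
  qed
  then have s: "s > 0"
    unfolding s_def using i0(1) by (intro sum_pos2[where i = i0]) auto
  \<comment> \<open>With P_i = a_i P_{i0}, the sum of conj(P_i(w)) P_i(z) is s conj(P_{i0}(w))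
    P_{i0}(z), so the square root of \<open>s\<close> merges all generators into one.\<close>
  define \<phi> where "\<phi> z = complex_of_real (sqrt s) * poly_fun (p i0) z" for z
  have "\<exists>c. \<forall>z\<in>small_box. \<phi> z = c"
  proof (rule rank_1_constant[OF assms(1)])
    show "multiplier \<phi>"
      unfolding \<phi>_def[abs_def] by (intro multiplier_mult multiplier_const multiplier_poly_fun)
    have "mult_op \<phi> (K 0) = cscale (complex_of_real (sqrt s)) (P i0)"
      by (auto simp: mult_op_def \<phi>_def P_def)
    then show "mult_op \<phi> (K 0) \<in> S"
      using P_mem_S[OF i0(1)] by (simp only: S.mem_scale)
    show "kS w = cscale (cnj (\<phi> w)) (mult_op \<phi> (K w))" if w: "w \<in> D" for w
    proof
      fix z
      show "kS w z = cscale (cnj (\<phi> w)) (mult_op \<phi> (K w)) z"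
      proof (cases "z \<in> D")
        case True
        have "(\<Sum>i\<in>{1..n}. cnj (P i w) * P i z)
            = (\<Sum>i\<in>{1..n}. of_real ((cmod (a i))\<^sup>2) * (cnj (P i0 w) * P i0 z))"
          by (intro sum.cong refl) (simp add: a complex_norm_square mult_ac del: of_real_power)
        also have "\<dots> = of_real s * (cnj (P i0 w) * P i0 z)"
          by (simp add: s_def sum_distrib_right)
        also have "complex_of_real s = of_real (sqrt s) * of_real (sqrt s)"
          using s by (simp flip: of_real_mult)
        finally have sum: "(\<Sum>i\<in>{1..n}. cnj (P i w) * P i z)
            = of_real (sqrt s) * of_real (sqrt s) * (cnj (P i0 w) * P i0 z)" .
        show ?thesis
          unfolding kS_apply sum using True w by (simp add: mult_op_def \<phi>_def P_apply mult_ac)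
      next
        case False
        then show ?thesis unfolding kS_apply by (simp add: mult_op_def K_outside)
      qed
    qed
    obtain v0 where v0: "v0 \<in> D" "poly_fun (p i0) v0 \<noteq> 0"
      using P_nonzero[OF i0(1)] eqI_D[OF P_mem mem_zero, of i0] P_apply by fastforce
    have "{v \<in> D. \<phi> v \<noteq> 0} = {v \<in> D. poly_fun (p i0) v \<noteq> 0}"
      using s by (simp add: \<phi>_def)
    then show "D \<subseteq> closure {v \<in> D. \<phi> v \<noteq> 0}"
      using poly_fun_nonzero_dense[OF v0] by auto
  qed
  then obtain c where c: "\<And>z. z \<in> small_box \<Longrightarrow> \<phi> z = c" by blast
  have "poly_fun (p i0) z = c / of_real (sqrt s)" if "z \<in> small_box" for z
    using c[OF that] s by (simp add: \<phi>_def field_simps)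
  then have "constant_poly (p i0)" by (rule poly_fun_const_on_small_box)
  then show False using assms(6)[OF i0(1)] by blast
qed

end
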